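(* Let $X_e=(H\times H)\times X\rightrightarrows H\times\mathfrak h^*$ be the product groupoid of the coarse groupoid $H\times H\rightrightarrows H$ with $X$, let $J_-:X^*\to H\times\mathfrak h^*$, $J_-(h,p,u)=(h,p)$, and define $\Psi^+:X^*\ast_{J_-}X_e\to X^*$ by $$\Psi^+_{(h,k,p,g,q)}(h,p,u)=(k,q,\varphi^+_{hgk^{-1}}(u)).$$ Then $\Psi^+$ is a right groupoid action of $X_e$ on $X^*$ with moment map $J_-$, and $\Psi^+_{(h,h,p,g,q)}(h,p,u)=\psi^+_{(p,g,q)}(h,p,u)$ for all $(h,p,u)\in X^*$, $(p,g,q)\in X$, where $\psi^+_{(p,g,q)}(h,p,u)=(h,q,\varphi^+_{hgh^{-1}}(u))$.
   Context: Setting. $G$ is a connected, simply connected Lie group, $H\subset G$ a connected, simply connected Lie subgroup, $\mathfrak g,\mathfrak h$ their Lie algebras, $\iota:\mathfrak h\to\mathfrak g$ the inclusion. $\mathrm{Ad}^*_x,\mathrm{ad}^*_Y$ are the transposes of $\mathrm{Ad}_x,\mathrm{ad}_Y$. $R:\mathfrak g^*\to\mathfrak g$ is linear, skew-symmetric, such that $\kappa(A,B)=-[RA,RB]-R\,\mathrm{ad}^*_{RA}B+R\,\mathrm{ad}^*_{RB}A$ satisfies $\mathrm{ad}_Y\kappa(A,B)+\kappa(\mathrm{ad}^*_YA,B)+\kappa(A,\mathrm{ad}^*_YB)=0$ for $Y\in\mathfrak g$, and $R\,\mathrm{ad}^*_{\iota Z}+\mathrm{ad}_{\iota Z}R=0$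 for $Z\in\mathfrak h$. Poisson Lie groups. $G$ with $\{f,g\}_G=\langle R(Df),Dg\rangle-\langle R(D'f),D'g\rangle$ ($\langle Df,Y\rangle=\frac{d}{dt}|_0f(e^{tY}x)$, $\langle D'f,Y\rangle=\frac{d}{dt}|_0f(xe^{tY})$) is a Poisson Lie group; $(G^*,\{\,,\,\}_* )$ is the connected, simply connected dual Poisson Lie group, with Lie algebra $\mathfrak g^*$, $[A,B]_*=\mathrm{ad}^*_{R(A)}B-\mathrm{ad}^*_{R(B)}A$. $\varphi^+$ is the right dressing action of $G$ on $G^*$, with generators $\lambda^+(Y)(u)=\frac{d}{dt}|_0\varphi^+_{e^{tY}}(u)$ determined by $\{\phi,\psi\}_*(u)=-d\phi(u)\lambda^+(T_1l_u^*d\psi(u))(u)$. $G$ is assumed complete, i.e. the dressing actions are globally defined. $I^*:G^*\to\mathfrak h^*$ is the Lie group morphism integrating $\iota^*:\mathfrak g^*\to\mathfrak h^*$. Groupoids. Lie groupoids have target $\alpha$, source $\beta$, unit $\epsilon$; $(x,y)$ composable iff $\beta(x)=\alpha(y)$. $X=\mathfrak h^*\times G\times\mathfrak h^*$: $\alpha(p,g,q)=p$, $\beta(p,g,q)=q$, $(p,g,q)(q,g',r)=(p,gg',r)$. $X^*=H\times\mathfrak h^*\times G^*$: $\alpha(h,p,u)=\mathrm{Ad}^*_{h^{-1}}p+I^*(u)$, $\beta(h,p,u)=p$, $(h,\alpha(k,q,v),u)\cdot(k,q,v)=(hk,q,u\varphi^+_{h^{-1}}(v))$. Coarse groupoid $H\times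 H$: $\alpha(h,k)=h$, $\beta(h,k)=k$, $(h,k)(k,l)=(h,l)$. So in $X_e$: $\alpha(h,k,p,g,q)=(h,p)$, $\beta(h,k,p,g,q)=(k,q)$. Actions. A right action of $\Gamma\rightrightarrows B$ on $S$ with moment map $f:S\to B$ is a smooth map $S\ast_f\Gamma=\{(s,x)\mid f(s)=\alpha(x)\}\to S$, $(s,x)\mapsto s\cdot x$, with $f(s\cdot x)=\beta(x)$, $(s\cdot x)\cdot y=s\cdot(xy)$, $t\cdot\epsilon(f(t))=t$; here $\Psi^+_x(s)$ denotes $s\cdot x$. *)

theory Defs
  imports "HOL-Analysis.Analysis" "HOL-Algebra.Group"
begin

text \<open>
  The class \<open>euclidean_space\<close> excludes the zero space, but the subgroup \<open>H\<close> below may be trivial.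
\<close>

class fin_dim = real_normed_vector +
  assumes finite_spanning_set: "\<exists>B. finite B \<and> (\<forall>x. \<exists>c. x = (\<Sum>b\<in>B. c b *\<^sub>R b))"

lemma fin_dim_iff:
  "(\<exists>B. finite B \<and> (\<forall>x::'a::real_vector. \<exists>c. x = (\<Sum>b\<in>B. c b *\<^sub>R b))) \<longleftrightarrow>
    (\<exists>B. finite B \<and> span B = (UNIV :: 'a set))"
proof -
  have "(\<forall>x. \<exists>c. x = (\<Sum>b\<in>B. c b *\<^sub>R b)) \<longleftrightarrow> span B = UNIV" if "finite B" for B :: "'a set"
    unfolding span_finite[OF that] by (auto simp: set_eq_iff image_iff)
  then show ?thesis by metis
qed

lemma fin_dim: "\<exists>B. finite B \<and> span B = (UNIV :: 'a::fin_dim set)"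
  using finite_spanning_set[where 'a = 'a] unfolding fin_dim_iff .

lemma fin_dim_subspace_span:
  fixes V :: "'a::fin_dim set"
  assumes "subspace V"
  obtains B where "finite B" "B \<subseteq> V" "span B = V"
proof -
  obtain B0 :: "'a set" where B0: "finite B0" "span B0 = UNIV"
    using fin_dim by blast
  obtain B where B: "B \<subseteq> V" "independent B" "V \<subseteq> span B"
    using maximal_independent_subset .
  have "finite B"
    using independent_span_bound[OF B0(1) B(2)] B0(2) by simp
  moreover have "span B = V"
    using B assms by (simp add: span_minimal subset_antisym)
  ultimately show thesis
    using that B(1) by blast
qed

instance euclidean_space \<subseteq> fin_dim
  by standard (unfold fin_dim_iff, rule exI[of _ Basis], simp)

instance prod :: (fin_dim, fin_dim) fin_dim
proof
  obtain B :: "'a set" where B: "finite B" "span B = UNIV"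
    using fin_dim by blast
  obtain C :: "'b set" where C: "finite C" "span C = UNIV"
    using fin_dim by blast
  have 1: "(x, 0) \<in> span ((\<lambda>b. (b, 0)) ` B \<union> Pair 0 ` C)" for x :: 'a
  proof -
    have lin: "linear (\<lambda>b::'a. (b, 0::'b))"
      by (rule linearI) auto
    have "(\<lambda>b::'a. (b, 0::'b)) ` span B = span ((\<lambda>b. (b, 0)) ` B)"
      by (rule linear_span_image[OF lin, symmetric])
    then show ?thesis
      using B(2) span_mono[of "(\<lambda>b. (b, 0)) ` B" "(\<lambda>b. (b, 0)) ` B \<union> Pair 0 ` C"] by blast
  qed
  have 2: "(0, y) \<in> span ((\<lambda>b. (b, 0)) ` B \<union> Pair 0 ` C)" for y :: 'b
  proof -
    have lin: "linear (Pair (0::'a) :: 'b \<Rightarrow> _)"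
      by (rule linearI) auto
    have "Pair (0::'a) ` span C = span (Pair 0 ` C)"
      by (rule linear_span_image[OF lin, symmetric])
    then show ?thesis
      using C(2) span_mono[of "Pair 0 ` C" "(\<lambda>b. (b, 0)) ` B \<union> Pair 0 ` C"] by blast
  qed
  have "z \<in> span ((\<lambda>b. (b, 0)) ` B \<union> Pair 0 ` C)" for z :: "'a \<times> 'b"
    using span_add[OF 1[of "fst z"] 2[of "snd z"]] by simp
  then show "\<exists>D. finite D \<and> (\<forall>x :: 'a \<times> 'b. \<exists>c. x = (\<Sum>b\<in>D. c b *\<^sub>R b))"
    unfolding fin_dim_iff using B(1) C(1) by (intro exI[of _ "(\<lambda>b. (b, 0)) ` B \<union> Pair 0 ` C"]) auto
qed

instance blinfun :: (fin_dim, fin_dim) fin_dim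
proof
  have ext: "\<exists>F. finite F \<and> (\<forall>A. \<exists>A'\<in>span F. \<forall>b\<in>B. blinfun_apply (A :: 'a \<Rightarrow>\<^sub>L 'b) b = blinfun_apply A' b)"
    if "finite B" for B :: "'a set"
    using that
  proof (induction B)
    case empty
    then show ?case by (intro exI[of _ "{}"]) auto
  next
    case (insert b B)
    obtain F :: "('a \<Rightarrow>\<^sub>L 'b) set" where F: "finite F"
      "\<And>A. \<exists>A'\<in>span F. \<forall>b\<in>B. blinfun_apply A b = blinfun_apply A' b"
      using insert.IH by blast
    let ?K = "{A :: 'a \<Rightarrow>\<^sub>L 'b. \<forall>c\<in>B. blinfun_apply A c = 0}"
    have K: "subspace ?K"
      by (auto simp: subspace_def blinfun.bilinear_simps)
    have lin: "linear (\<lambda>A :: 'a \<Rightarrow>\<^sub>L 'b. blinfun_apply A b)"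
      by (rule linearI) (auto simp: blinfun.bilinear_simps)
    obtain C where C: "finite C" "C \<subseteq> (\<lambda>A. blinfun_apply A b) ` ?K"
      "span C = (\<lambda>A. blinfun_apply A b) ` ?K"
      using fin_dim_subspace_span[OF linear_subspace_image[OF lin K]] .
    obtain E where E: "finite E" "E \<subseteq> ?K" "C = (\<lambda>A. blinfun_apply A b) ` E"
      using finite_subset_image[OF C(1,2)] by blast
    have "\<exists>A'\<in>span (F \<union> E). \<forall>c\<in>insert b B. blinfun_apply A c = blinfun_apply A' c" for A
    proof -
      obtain A1 where A1: "A1 \<in> span F" "\<forall>c\<in>B. blinfun_apply A c = blinfun_apply A1 c"
        using F(2) by blast
      have "A - A1 \<in> ?K"
        using A1(2) by (auto simp: blinfun.bilinear_simps)
      then have "blinfun_apply (A - A1) b \<in> span C"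
        using C(3) by blast
      also have "span C = (\<lambda>A. blinfun_apply A b) ` span E"
        unfolding E(3) by (rule linear_span_image[OF lin])
      finally obtain A2 where A2: "A2 \<in> span E" "blinfun_apply (A - A1) b = blinfun_apply A2 b"
        by blast
      have "A2 \<in> ?K"
        using A2(1) E(2) span_minimal[OF E(2) K] by blast
      then have "\<forall>c\<in>insert b B. blinfun_apply A c = blinfun_apply (A1 + A2) c"
        using A1(2) A2(2) by (auto simp: blinfun.bilinear_simps algebra_simps)
      moreover have "A1 + A2 \<in> span (F \<union> E)"
        using A1(1) A2(1) span_mono[of F "F \<union> E"] span_mono[of E "F \<union> E"]
        by (intro span_add) auto
      ultimately show ?thesis by blast
    qed
    then show ?case
      using F(1) E(1) by (intro exI[of _ "F \<union> E"]) auto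
  qed
  obtain B :: "'a set" where B: "finite B" "span B = UNIV"
    using fin_dim by blast
  obtain F :: "('a \<Rightarrow>\<^sub>L 'b) set" where F: "finite F"
    "\<And>A. \<exists>A'\<in>span F. \<forall>b\<in>B. blinfun_apply A b = blinfun_apply A' b"
    using ext[OF B(1)] by blast
  have "A \<in> span F" for A
  proof -
    obtain A' where A': "A' \<in> span F" "\<forall>b\<in>B. blinfun_apply A b = blinfun_apply A' b"
      using F(2) by blast
    have "blinfun_apply A x = blinfun_apply A' x" for x
      using linear_eq_on[of "blinfun_apply A" "blinfun_apply A'" x B] A'(2) B(2)
      by (simp add: bounded_linear.linear blinfun.bounded_linear_right)
    then have "A = A'"
      by (rule blinfun_eqI)
    then show ?thesis
      using A'(1) by simp
  qed
  then show "\<exists>F. finite F \<and> (\<forall>x :: 'a \<Rightarrow>\<^sub>L 'b. \<exists>c. x = (\<Sum>b\<in>F. c b *\<^sub>R b))"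
    unfolding fin_dim_iff using F(1) by blast
qed

text \<open>
  The dual space; the pairing of \<open>A :: 'a dual\<close> with \<open>Y :: 'a\<close> is \<open>blinfun_apply A Y\<close>, and the
  transpose of \<open>T :: 'a \<Rightarrow>\<^sub>L 'b\<close> is \<open>\<lambda>A. A o\<^sub>L T\<close>.
\<close>

type_synonym 'a dual = "'a \<Rightarrow>\<^sub>L real"

definition from_bidual :: "'a::fin_dim dual dual \<Rightarrow> 'a"
  where "from_bidual W = (THE Y. \<forall>A. blinfun_apply W A = blinfun_apply A Y)"

text \<open>For open \<open>S\<close>: all iterated directional derivatives of order at most \<open>k\<close> are continuous on \<open>S\<close>.\<close>

primrec Ck_on :: "nat \<Rightarrow> ('a::fin_dim \<Rightarrow> 'b::fin_dim) \<Rightarrow> 'a set \<Rightarrow> bool" where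
  "Ck_on 0 f S \<longleftrightarrow> continuous_on S f"
| "Ck_on (Suc k) f S \<longleftrightarrow>
     (\<forall>x\<in>S. f differentiable (at x)) \<and> (\<forall>v. Ck_on k (\<lambda>x. frechet_derivative f (at x) v) S)"

definition smooth_on :: "('a::fin_dim \<Rightarrow> 'b::fin_dim) \<Rightarrow> 'a set \<Rightarrow> bool"
  where "smooth_on f S \<longleftrightarrow> (\<forall>k. Ck_on k f S)"

text \<open>
  A manifold with points in \<open>'a\<close> modelled on \<open>'b\<close>. An element \<open>(U, c)\<close> of the atlas is a chart \<open>c\<close>
  with domain \<open>U\<close>; the atlas need not be maximal.
\<close>

record ('a, 'b) manifold =
  mtop :: "'a topology"
  atlas :: "('a set \<times> ('a \<Rightarrow> 'b)) set"

abbreviation points :: "('a, 'b, 'm) manifold_scheme \<Rightarrow> 'a set"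
  where "points M \<equiv> topspace (mtop M)"

definition smooth_manifold :: "('a, 'b::fin_dim) manifold \<Rightarrow> bool" where
  "smooth_manifold M \<longleftrightarrow>
     Hausdorff_space (mtop M) \<and> second_countable (mtop M) \<and>
     (\<Union>(U, c)\<in>atlas M. U) = points M \<and>
     (\<forall>(U, c)\<in>atlas M. openin (mtop M) U \<and> open (c ` U) \<and>
        homeomorphic_map (subtopology (mtop M) U) (top_of_set (c ` U)) c) \<and>
     (\<forall>(U, c)\<in>atlas M. \<forall>(V, d)\<in>atlas M. smooth_on (d \<circ> inv_into U c) (c ` (U \<inter> V)))"

definition smooth_map ::
  "('a, 'b::fin_dim) manifold \<Rightarrow> ('c, 'd::fin_dim) manifold \<Rightarrow> ('a \<Rightarrow> 'c) \<Rightarrow> bool" where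
  "smooth_map M N f \<longleftrightarrow>
     continuous_map (mtop M) (mtop N) f \<and>
     (\<forall>(U, c)\<in>atlas M. \<forall>(V, d)\<in>atlas N.
        smooth_on (d \<circ> f \<circ> inv_into U c) (c ` {x \<in> U. f x \<in> V}))"

definition open_submanifold :: "('a, 'b) manifold \<Rightarrow> 'a set \<Rightarrow> ('a, 'b) manifold" where
  "open_submanifold M W =
     \<lparr>mtop = subtopology (mtop M) W, atlas = {(U \<inter> W, c) |U c. (U, c) \<in> atlas M}\<rparr>"

text \<open>
  Smoothness on an arbitrary subset, by local smooth extension. If \<open>A\<close> is an embedded submanifold,
  this is smoothness for its induced manifold structure; it is applied only to fibre products over a
  submersion.
\<close>

definition smooth_map_on ::
  "('a, 'b::fin_dim) manifold \<Rightarrow> 'a set \<Rightarrow> ('c, 'd::fin_dim) manifold \<Rightarrow> ('a \<Rightarrow> 'c) \<Rightarrow> bool" where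
  "smooth_map_on M A N f \<longleftrightarrow>
     (\<forall>x\<in>A. \<exists>W F. openin (mtop M) W \<and> x \<in> W \<and> smooth_map (open_submanifold M W) N F \<and>
        (\<forall>y\<in>A \<inter> W. F y = f y))"

definition chart_derivative ::
  "'a set \<times> ('a \<Rightarrow> 'b::fin_dim) \<Rightarrow> 'c set \<times> ('c \<Rightarrow> 'd::fin_dim) \<Rightarrow> ('a \<Rightarrow> 'c) \<Rightarrow> 'a \<Rightarrow> 'b \<Rightarrow> 'd" where
  "chart_derivative C D f x =
     frechet_derivative (snd D \<circ> f \<circ> inv_into (fst C) (snd C)) (at (snd C x))"

definition immersion ::
  "('a, 'b::fin_dim) manifold \<Rightarrow> ('c, 'd::fin_dim) manifold \<Rightarrow> ('a \<Rightarrow> 'c) \<Rightarrow> bool" where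
  "immersion M N f \<longleftrightarrow> smooth_map M N f \<and>
     (\<forall>C\<in>atlas M. \<forall>D\<in>atlas N. \<forall>x\<in>fst C. f x \<in> fst D \<longrightarrow> inj (chart_derivative C D f x))"

definition submersion ::
  "('a, 'b::fin_dim) manifold \<Rightarrow> ('c, 'd::fin_dim) manifold \<Rightarrow> ('a \<Rightarrow> 'c) \<Rightarrow> bool" where
  "submersion M N f \<longleftrightarrow> smooth_map M N f \<and>
     (\<forall>C\<in>atlas M. \<forall>D\<in>atlas N. \<forall>x\<in>fst C. f x \<in> fst D \<longrightarrow> surj (chart_derivative C D f x))"

definition prod_manifold ::
  "('a, 'b) manifold \<Rightarrow> ('c, 'd) manifold \<Rightarrow> ('a \<times> 'c, 'b \<times> 'd) manifold"  (infixr \<open>\<times>\<^sub>M\<close> 80) where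
  "M \<times>\<^sub>M N =
     \<lparr>mtop = prod_topology (mtop M) (mtop N),
      atlas = {(U \<times> V, map_prod c d) |U c V d. (U, c) \<in> atlas M \<and> (V, d) \<in> atlas N}\<rparr>"

definition vec_mfd :: "('a::fin_dim, 'a) manifold"
  where "vec_mfd = \<lparr>mtop = euclidean, atlas = {(UNIV, id)}\<rparr>"

definition smooth_functions :: "('a, 'b::fin_dim) manifold \<Rightarrow> ('a \<Rightarrow> real) set"
  where "smooth_functions M = {f. smooth_map M vec_mfd f}"

definition simply_connected_space :: "'a topology \<Rightarrow> bool" where
  "simply_connected_space X \<longleftrightarrow>
     (\<forall>p q. continuous_map (top_of_set {0..1::real}) X p \<and> p 1 = p 0 \<and>
            continuous_map (top_of_set {0..1}) X q \<and> q 1 = q 0 \<longrightarrow>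
            homotopic_with (\<lambda>r. r 1 = r 0) (top_of_set {0..1}) X p q)"

text \<open>
  A Lie group modelled on \<open>'b\<close> comes with its exponential map, which presents its Lie algebra as \<open>'b\<close>:
  the differential of \<open>expm\<close> at \<open>0\<close> identifies \<open>'b\<close> with the tangent space at the unit, and
  \<open>t \<mapsto> expm (t *\<^sub>R Y)\<close> is the one-parameter subgroup generated by \<open>Y\<close>.
\<close>

record ('a, 'b) lie_group = "'a monoid" +
  mfd :: "('a, 'b) manifold"
  expm :: "'b \<Rightarrow> 'a"

definition lie_group :: "('a, 'b::fin_dim) lie_group \<Rightarrow> bool" where
  "lie_group G \<longleftrightarrow>
     Group.group G \<and> smooth_manifold (mfd G) \<and> points (mfd G) = carrier G \<and>
     smooth_map (mfd G \<times>\<^sub>M mfd G) (mfd G) (\<lambda>(x, y). x \<otimes>\<^bsub>G\<^esub> y) \<and>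
     smooth_map (mfd G) (mfd G) (\<lambda>x. inv\<^bsub>G\<^esub> x) \<and>
     smooth_map vec_mfd (mfd G) (expm G) \<and>
     (\<forall>s t Y. expm G ((s + t) *\<^sub>R Y) = expm G (s *\<^sub>R Y) \<otimes>\<^bsub>G\<^esub> expm G (t *\<^sub>R Y)) \<and>
     (\<forall>D\<in>atlas (mfd G). \<one>\<^bsub>G\<^esub> \<in> fst D \<longrightarrow> bij (chart_derivative (UNIV, id) D (expm G) 0))"

definition connected_simply_connected :: "('a, 'b) lie_group \<Rightarrow> bool" where
  "connected_simply_connected G \<longleftrightarrow>
     connected_space (mtop (mfd G)) \<and> simply_connected_space (mtop (mfd G))"

definition Ad :: "('a, 'b::fin_dim) lie_group \<Rightarrow> 'a \<Rightarrow> 'b \<Rightarrow>\<^sub>L 'b" where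
  "Ad G x = Blinfun (\<lambda>Y. THE Z. \<forall>t.
     expm G (t *\<^sub>R Z) = x \<otimes>\<^bsub>G\<^esub> expm G (t *\<^sub>R Y) \<otimes>\<^bsub>G\<^esub> inv\<^bsub>G\<^esub> x)"

text \<open>The Lie bracket is \<open>[Y, Z] = ad G Y Z\<close>.\<close>

definition ad :: "('a, 'b::fin_dim) lie_group \<Rightarrow> 'b \<Rightarrow> 'b \<Rightarrow>\<^sub>L 'b" where
  "ad G Y = Blinfun (\<lambda>Z. vector_derivative (\<lambda>t. blinfun_apply (Ad G (expm G (t *\<^sub>R Y))) Z) (at 0))"

definition Ad_star :: "('a, 'b::fin_dim) lie_group \<Rightarrow> 'a \<Rightarrow> 'b dual \<Rightarrow> 'b dual"
  where "Ad_star G x A = A o\<^sub>L Ad G x"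

definition ad_star :: "('a, 'b::fin_dim) lie_group \<Rightarrow> 'b \<Rightarrow> 'b dual \<Rightarrow> 'b dual"
  where "ad_star G Y A = A o\<^sub>L ad G Y"

text \<open>
  The manifold structure of a Lie subgroup is its own: its topology may be finer than the subspace
  topology.
\<close>

definition lie_subgroup :: "('a, 'c::fin_dim) lie_group \<Rightarrow> ('a, 'b::fin_dim) lie_group \<Rightarrow> bool" where
  "lie_subgroup H G \<longleftrightarrow>
     lie_group H \<and> lie_group G \<and> subgroup (carrier H) G \<and>
     (\<forall>x\<in>carrier H. \<forall>y\<in>carrier H. x \<otimes>\<^bsub>H\<^esub> y = x \<otimes>\<^bsub>G\<^esub> y) \<and>
     immersion (mfd H) (mfd G) (\<lambda>x. x)"

definition lie_inclusion :: "('a, 'c::fin_dim) lie_group \<Rightarrow> ('a, 'b::fin_dim) lie_group \<Rightarrow> 'c \<Rightarrow>\<^sub>L 'b" where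
  "lie_inclusion H G = Blinfun (\<lambda>Z. THE Y. \<forall>t. expm G (t *\<^sub>R Y) = expm H (t *\<^sub>R Z))"

text \<open>These are \<open>Df(x)\<close> and \<open>D'f(x)\<close>, with \<open>e\<^sup>t\<^sup>Y = expm G (t *\<^sub>R Y)\<close>.\<close>

definition Dl :: "('a, 'b::fin_dim) lie_group \<Rightarrow> ('a \<Rightarrow> real) \<Rightarrow> 'a \<Rightarrow> 'b dual"
  where "Dl G f x = Blinfun (\<lambda>Y. deriv (\<lambda>t. f (expm G (t *\<^sub>R Y) \<otimes>\<^bsub>G\<^esub> x)) 0)"

definition Dr :: "('a, 'b::fin_dim) lie_group \<Rightarrow> ('a \<Rightarrow> real) \<Rightarrow> 'a \<Rightarrow> 'b dual"
  where "Dr G f x = Blinfun (\<lambda>Y. deriv (\<lambda>t. f (x \<otimes>\<^bsub>G\<^esub> expm G (t *\<^sub>R Y))) 0)"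

type_synonym 'a bracket = "('a \<Rightarrow> real) \<Rightarrow> ('a \<Rightarrow> real) \<Rightarrow> 'a \<Rightarrow> real"

definition poisson_bracket :: "('a, 'b::fin_dim) manifold \<Rightarrow> 'a bracket \<Rightarrow> bool" where
  "poisson_bracket M br \<longleftrightarrow>
     (\<forall>f\<in>smooth_functions M. \<forall>g\<in>smooth_functions M. br f g \<in> smooth_functions M) \<and>
     (\<forall>f\<in>smooth_functions M. \<forall>g\<in>smooth_functions M. \<forall>h\<in>smooth_functions M. \<forall>a b. \<forall>x\<in>points M.
        br (\<lambda>y. a * f y + b * g y) h x = a * br f h x + b * br g h x \<and>
        br f g x = - br g f x \<and>
        br (\<lambda>y. f y * g y) h x = f x * br g h x + g x * br f h x \<and>
        br f (br g h) x + br g (br h f) x + br h (br f g) x = 0)"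

text \<open>The last conjunct says that the multiplication is a Poisson map.\<close>

definition poisson_lie_group :: "('a, 'b::fin_dim) lie_group \<Rightarrow> 'a bracket \<Rightarrow> bool" where
  "poisson_lie_group G br \<longleftrightarrow>
     lie_group G \<and> poisson_bracket (mfd G) br \<and>
     (\<forall>f\<in>smooth_functions (mfd G). \<forall>g\<in>smooth_functions (mfd G). \<forall>x\<in>carrier G. \<forall>y\<in>carrier G.
        br f g (x \<otimes>\<^bsub>G\<^esub> y) =
          br (\<lambda>z. f (z \<otimes>\<^bsub>G\<^esub> y)) (\<lambda>z. g (z \<otimes>\<^bsub>G\<^esub> y)) x +
          br (\<lambda>z. f (x \<otimes>\<^bsub>G\<^esub> z)) (\<lambda>z. g (x \<otimes>\<^bsub>G\<^esub> z)) y)"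

text \<open>
  Sign convention: the Lie bracket of either group is the linearization at the unit of the Poisson
  bracket of the other one, without a sign.
\<close>

definition dual_poisson_lie_groups ::
  "('a, 'b::fin_dim) lie_group \<Rightarrow> 'a bracket \<Rightarrow> ('u, 'b dual) lie_group \<Rightarrow> 'u bracket \<Rightarrow> bool" where
  "dual_poisson_lie_groups G br Gs brs \<longleftrightarrow>
     poisson_lie_group G br \<and> poisson_lie_group Gs brs \<and>
     (\<forall>f\<in>smooth_functions (mfd G). \<forall>g\<in>smooth_functions (mfd G).
        Dl G (br f g) \<one>\<^bsub>G\<^esub> = blinfun_apply (ad Gs (Dl G f \<one>\<^bsub>G\<^esub>)) (Dl G g \<one>\<^bsub>G\<^esub>)) \<and>
     (\<forall>f\<in>smooth_functions (mfd Gs). \<forall>g\<in>smooth_functions (mfd Gs).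
        from_bidual (Dl Gs (brs f g) \<one>\<^bsub>Gs\<^esub>) =
          blinfun_apply (ad G (from_bidual (Dl Gs f \<one>\<^bsub>Gs\<^esub>))) (from_bidual (Dl Gs g \<one>\<^bsub>Gs\<^esub>)))"

definition R_bracket ::
  "('a, 'b::fin_dim) lie_group \<Rightarrow> ('b dual \<Rightarrow>\<^sub>L 'b) \<Rightarrow> 'a bracket" where
  "R_bracket G R f g x =
     blinfun_apply (Dl G g x) (blinfun_apply R (Dl G f x)) -
     blinfun_apply (Dr G g x) (blinfun_apply R (Dr G f x))"

definition kappa ::
  "('a, 'b::fin_dim) lie_group \<Rightarrow> ('b dual \<Rightarrow>\<^sub>L 'b) \<Rightarrow> 'b dual \<Rightarrow> 'b dual \<Rightarrow> 'b" where
  "kappa G R A B =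
     - blinfun_apply (ad G (blinfun_apply R A)) (blinfun_apply R B)
     - blinfun_apply R (ad_star G (blinfun_apply R A) B)
     + blinfun_apply R (ad_star G (blinfun_apply R B) A)"

text \<open>
  The generator \<open>\<lambda>\<^sup>+(Y)(u)\<close> of the flow \<open>phi (expm G (t *\<^sub>R Y))\<close>, acting on a function \<open>f\<close> as the
  derivation \<open>df(u) \<lambda>\<^sup>+(Y)(u)\<close>.
\<close>

definition generator ::
  "('a, 'b::fin_dim) lie_group \<Rightarrow> ('a \<Rightarrow> 'u \<Rightarrow> 'u) \<Rightarrow> 'b \<Rightarrow> 'u \<Rightarrow> ('u \<Rightarrow> real) \<Rightarrow> real"
  where "generator G phi Y u f = deriv (\<lambda>t. f (phi (expm G (t *\<^sub>R Y)) u)) 0"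

text \<open>
  \<open>phi x u\<close> is \<open>\<phi>\<^sup>+\<^sub>x(u)\<close>. The transpose of the derivative of left translation by \<open>u\<close>, applied to
  \<open>dg(u)\<close>, is \<open>Dr Gs g u\<close>, an element of the bidual. That \<open>phi\<close> is defined on the whole group
  expresses completeness.
\<close>

definition right_dressing_action ::
  "('a, 'b::fin_dim) lie_group \<Rightarrow> ('u, 'b dual) lie_group \<Rightarrow> 'u bracket \<Rightarrow> ('a \<Rightarrow> 'u \<Rightarrow> 'u) \<Rightarrow> bool" where
  "right_dressing_action G Gs brs phi \<longleftrightarrow>
     smooth_map (mfd G \<times>\<^sub>M mfd Gs) (mfd Gs) (\<lambda>(x, u). phi x u) \<and>
     (\<forall>u\<in>carrier Gs. phi \<one>\<^bsub>G\<^esub> u = u) \<and>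
     (\<forall>x\<in>carrier G. \<forall>y\<in>carrier G. \<forall>u\<in>carrier Gs. phi (x \<otimes>\<^bsub>G\<^esub> y) u = phi y (phi x u)) \<and>
     (\<forall>f\<in>smooth_functions (mfd Gs). \<forall>g\<in>smooth_functions (mfd Gs). \<forall>u\<in>carrier Gs.
        brs f g u = - generator G phi (from_bidual (Dr Gs g u)) u f)"

definition integrates_inclusion_transpose ::
  "('a, 'c::fin_dim) lie_group \<Rightarrow> ('a, 'b::fin_dim) lie_group \<Rightarrow> ('u, 'b dual) lie_group \<Rightarrow>
    ('u \<Rightarrow> 'c dual) \<Rightarrow> bool" where
  "integrates_inclusion_transpose H G Gs I \<longleftrightarrow>
     smooth_map (mfd Gs) vec_mfd I \<and>
     (\<forall>u\<in>carrier Gs. \<forall>v\<in>carrier Gs. I (u \<otimes>\<^bsub>Gs\<^esub> v) = I u + I v) \<and>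
     (\<forall>A. ((\<lambda>t. I (expm Gs (t *\<^sub>R A))) has_vector_derivative (A o\<^sub>L lie_inclusion H G)) (at 0))"

text \<open>In \<open>gmult \<Gamma> x y\<close> the pair is composable iff \<open>src \<Gamma> x = tgt \<Gamma> y\<close>; other pairs are junk.\<close>

record ('a, 'm, 'b, 'n) groupoid =
  arrows :: "('a, 'm) manifold"
  base :: "('b, 'n) manifold"
  tgt :: "'a \<Rightarrow> 'b"
  src :: "'a \<Rightarrow> 'b"
  gunit :: "'b \<Rightarrow> 'a"
  gmult :: "'a \<Rightarrow> 'a \<Rightarrow> 'a"

definition lie_groupoid :: "('a, 'm::fin_dim, 'b, 'n::fin_dim) groupoid \<Rightarrow> bool" where
  "lie_groupoid \<Gamma> \<longleftrightarrow>
     smooth_manifold (arrows \<Gamma>) \<and> smooth_manifold (base \<Gamma>) \<and>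
     submersion (arrows \<Gamma>) (base \<Gamma>) (tgt \<Gamma>) \<and> submersion (arrows \<Gamma>) (base \<Gamma>) (src \<Gamma>) \<and>
     smooth_map (base \<Gamma>) (arrows \<Gamma>) (gunit \<Gamma>) \<and>
     smooth_map_on (arrows \<Gamma> \<times>\<^sub>M arrows \<Gamma>)
       {(x, y). x \<in> points (arrows \<Gamma>) \<and> y \<in> points (arrows \<Gamma>) \<and> src \<Gamma> x = tgt \<Gamma> y}
       (arrows \<Gamma>) (\<lambda>(x, y). gmult \<Gamma> x y) \<and>
     (\<forall>b\<in>points (base \<Gamma>). tgt \<Gamma> (gunit \<Gamma> b) = b \<and> src \<Gamma> (gunit \<Gamma> b) = b) \<and>
     (\<forall>x\<in>points (arrows \<Gamma>).
        gmult \<Gamma> (gunit \<Gamma> (tgt \<Gamma> x)) x = x \<and> gmult \<Gamma> x (gunit \<Gamma> (src \<Gamma> x)) = x) \<and>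
     (\<forall>x\<in>points (arrows \<Gamma>). \<forall>y\<in>points (arrows \<Gamma>). src \<Gamma> x = tgt \<Gamma> y \<longrightarrow>
        tgt \<Gamma> (gmult \<Gamma> x y) = tgt \<Gamma> x \<and> src \<Gamma> (gmult \<Gamma> x y) = src \<Gamma> y) \<and>
     (\<forall>x\<in>points (arrows \<Gamma>). \<forall>y\<in>points (arrows \<Gamma>). \<forall>z\<in>points (arrows \<Gamma>).
        src \<Gamma> x = tgt \<Gamma> y \<longrightarrow> src \<Gamma> y = tgt \<Gamma> z \<longrightarrow>
        gmult \<Gamma> (gmult \<Gamma> x y) z = gmult \<Gamma> x (gmult \<Gamma> y z)) \<and>
     (\<exists>i. smooth_map (arrows \<Gamma>) (arrows \<Gamma>) i \<and>
        (\<forall>x\<in>points (arrows \<Gamma>). tgt \<Gamma> (i x) = src \<Gamma> x \<and> src \<Gamma> (i x) = tgt \<Gamma> x \<and>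
           gmult \<Gamma> x (i x) = gunit \<Gamma> (tgt \<Gamma> x) \<and> gmult \<Gamma> (i x) x = gunit \<Gamma> (src \<Gamma> x)))"

definition fibre_product ::
  "('a, 'm, 'b, 'n) groupoid \<Rightarrow> ('s, 'k) manifold \<Rightarrow> ('s \<Rightarrow> 'b) \<Rightarrow> ('s \<times> 'a) set" where
  "fibre_product \<Gamma> S f = {(s, x). s \<in> points S \<and> x \<in> points (arrows \<Gamma>) \<and> f s = tgt \<Gamma> x}"

text \<open>\<open>act s x\<close> is the result of acting by the arrow \<open>x\<close> on \<open>s\<close>, relevant only if \<open>f s = tgt \<Gamma> x\<close>.\<close>

definition right_groupoid_action ::
  "('a, 'm::fin_dim, 'b, 'n::fin_dim) groupoid \<Rightarrow> ('s, 'k::fin_dim) manifold \<Rightarrow> ('s \<Rightarrow> 'b) \<Rightarrow>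
    ('s \<Rightarrow> 'a \<Rightarrow> 's) \<Rightarrow> bool" where
  "right_groupoid_action \<Gamma> S f act \<longleftrightarrow>
     lie_groupoid \<Gamma> \<and> smooth_manifold S \<and> smooth_map S (base \<Gamma>) f \<and>
     smooth_map_on (S \<times>\<^sub>M arrows \<Gamma>) (fibre_product \<Gamma> S f) S (\<lambda>(s, x). act s x) \<and>
     (\<forall>(s, x)\<in>fibre_product \<Gamma> S f. act s x \<in> points S \<and> f (act s x) = src \<Gamma> x) \<and>
     (\<forall>(s, x)\<in>fibre_product \<Gamma> S f. \<forall>y\<in>points (arrows \<Gamma>). src \<Gamma> x = tgt \<Gamma> y \<longrightarrow>
        act (act s x) y = act s (gmult \<Gamma> x y)) \<and>
     (\<forall>s\<in>points S. act s (gunit \<Gamma> (f s)) = s)"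

definition coarse_groupoid :: "('a, 'm) manifold \<Rightarrow> ('a \<times> 'a, 'm \<times> 'm, 'a, 'm) groupoid" where
  "coarse_groupoid M =
     \<lparr>arrows = M \<times>\<^sub>M M, base = M, tgt = fst, src = snd, gunit = (\<lambda>h. (h, h)),
      gmult = (\<lambda>(h, k) (k', l). (h, l))\<rparr>"

definition prod_groupoid ::
  "('a, 'm, 'b, 'n) groupoid \<Rightarrow> ('c, 'k, 'd, 'l) groupoid \<Rightarrow>
    ('a \<times> 'c, 'm \<times> 'k, 'b \<times> 'd, 'n \<times> 'l) groupoid" where
  "prod_groupoid \<Gamma> \<Delta> =
     \<lparr>arrows = arrows \<Gamma> \<times>\<^sub>M arrows \<Delta>, base = base \<Gamma> \<times>\<^sub>M base \<Delta>,
      tgt = map_prod (tgt \<Gamma>) (tgt \<Delta>), src = map_prod (src \<Gamma>) (src \<Delta>),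
      gunit = map_prod (gunit \<Gamma>) (gunit \<Delta>),
      gmult = (\<lambda>(a, c) (a', c'). (gmult \<Gamma> a a', gmult \<Delta> c c'))\<rparr>"

definition X_groupoid ::
  "('a, 'b::fin_dim) lie_group \<Rightarrow>
    ('c::fin_dim dual \<times> 'a \<times> 'c dual, 'c dual \<times> 'b \<times> 'c dual, 'c dual, 'c dual) groupoid" where
  "X_groupoid G =
     \<lparr>arrows = vec_mfd \<times>\<^sub>M mfd G \<times>\<^sub>M vec_mfd, base = vec_mfd, tgt = (\<lambda>(p, g, q). p), src = (\<lambda>(p, g, q). q),
      gunit = (\<lambda>p. (p, \<one>\<^bsub>G\<^esub>, p)), gmult = (\<lambda>(p, g, q) (q', g', r). (p, g \<otimes>\<^bsub>G\<^esub> g', r))\<rparr>"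

definition Xe_groupoid ::
  "('a, 'c::fin_dim) lie_group \<Rightarrow> ('a, 'b::fin_dim) lie_group \<Rightarrow>
    (('a \<times> 'a) \<times> ('c dual \<times> 'a \<times> 'c dual), ('c \<times> 'c) \<times> ('c dual \<times> 'b \<times> 'c dual),
     'a \<times> 'c dual, 'c \<times> 'c dual) groupoid" where
  "Xe_groupoid H G = prod_groupoid (coarse_groupoid (mfd H)) (X_groupoid G)"

definition Xstar_groupoid ::
  "('a, 'c::fin_dim) lie_group \<Rightarrow> ('u, 'b::fin_dim dual) lie_group \<Rightarrow> ('a \<Rightarrow> 'u \<Rightarrow> 'u) \<Rightarrow>
    ('u \<Rightarrow> 'c dual) \<Rightarrow>
    ('a \<times> 'c dual \<times> 'u, 'c \<times> 'c dual \<times> 'b dual, 'c dual, 'c dual) groupoid" where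
  "Xstar_groupoid H Gs phi I =
     \<lparr>arrows = mfd H \<times>\<^sub>M vec_mfd \<times>\<^sub>M mfd Gs, base = vec_mfd,
      tgt = (\<lambda>(h, p, u). Ad_star H (inv\<^bsub>H\<^esub> h) p + I u), src = (\<lambda>(h, p, u). p),
      gunit = (\<lambda>p. (\<one>\<^bsub>H\<^esub>, p, \<one>\<^bsub>Gs\<^esub>)),
      gmult = (\<lambda>(h, p, u) (k, q, v). (h \<otimes>\<^bsub>H\<^esub> k, q, u \<otimes>\<^bsub>Gs\<^esub> phi (inv\<^bsub>H\<^esub> h) v))\<rparr>"

definition J_minus :: "'a \<times> 'p \<times> 'u \<Rightarrow> 'a \<times> 'p"
  where "J_minus = (\<lambda>(h, p, u). (h, p))"

text \<open>
  On the fibre product along \<open>J_minus\<close>, the first and third components of the arrow are the given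
  \<open>h\<close> and \<open>p\<close>.
\<close>

definition Psi_plus ::
  "('a, 'b) lie_group \<Rightarrow> ('a \<Rightarrow> 'u \<Rightarrow> 'u) \<Rightarrow>
    'a \<times> 'p \<times> 'u \<Rightarrow> ('a \<times> 'a) \<times> ('p \<times> 'a \<times> 'p) \<Rightarrow> 'a \<times> 'p \<times> 'u" where
  "Psi_plus G phi = (\<lambda>(h, p, u) ((h', k), (p', g, q)). (k, q, phi (h \<otimes>\<^bsub>G\<^esub> g \<otimes>\<^bsub>G\<^esub> inv\<^bsub>G\<^esub> k) u))"

definition psi_plus ::
  "('a, 'b) lie_group \<Rightarrow> ('a \<Rightarrow> 'u \<Rightarrow> 'u) \<Rightarrow> 'a \<times> 'p \<times> 'u \<Rightarrow> 'p \<times> 'a \<times> 'p \<Rightarrow> 'a \<times> 'p \<times> 'u" where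
  "psi_plus G phi = (\<lambda>(h, p, u) (p', g, q). (h, q, phi (h \<otimes>\<^bsub>G\<^esub> g \<otimes>\<^bsub>G\<^esub> inv\<^bsub>G\<^esub> h) u))"

end

theory Submission
  imports Defs
begin

text \<open>
  The first component of the product \<open>H \<times> H\<close> moves \<open>h\<close> to \<open>k\<close>, and \<open>X\<close> moves \<open>p\<close> to \<open>q\<close>; the element of
  \<open>G\<close> that acts on \<open>u\<close> is \<open>h g k\<inverse>\<close>. The assignment \<open>((h, k), (p, g, q)) \<mapsto> h g k\<inverse>\<close> is a morphism from
  \<open>X\<^sub>e\<close> to the group \<open>G\<close>, because \<open>(h g k\<inverse>) (k g' l\<inverse>) = h (g g') l\<inverse>\<close> and \<open>h 1 h\<inverse> = 1\<close>. A right action of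
  \<open>G\<close> pulls back along such a morphism: the dressing action of \<open>h g k\<inverse>\<close> gives the last component of the
  result, while the first two components record the source of the arrow. With \<open>k = h\<close> the formula
  becomes that of \<open>\<psi>\<^sup>+\<close>.

  The remaining content is differential. One has to know that \<open>X\<^sub>e\<close> is a Lie groupoid and that the action
  is smooth. All maps involved are built from projections, pairings, group operations, the inclusion of
  \<open>H\<close> in \<open>G\<close> and the dressing action, so smoothness reduces to closure properties of smooth maps
  between manifolds, and these to the chain rule for \<open>Ck_on\<close>. Two observations avoid the theory of embedded
  submanifolds and of submersions. The formulas for the multiplication of \<open>X\<^sub>e\<close> and for \<open>\<Psi>\<^sup>+\<close> make sense
  for non-composable pairs too and are smooth there, so that smoothness on the fibre products
  is by restriction (\<open>smooth_map_imp_smooth_map_on\<close>). The target and source maps have smooth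
  global sections through every point, which makes their derivatives surjective by the chain rule
  (\<open>submersion_if_sections\<close>).
\<close>

section \<open>Finite-dimensional normed spaces\<close>

text \<open>
  By induction on \<open>B\<close>. The induction hypothesis makes coefficients of Cauchy sequences in \<open>span B\<close> Cauchy,
  so \<open>span B\<close> is closed and a new independent vector \<open>a\<close> has positive distance \<open>\<delta>\<close> from it. This bounds
  the coefficient of \<open>a\<close>, and with it the norm of the part in \<open>span B\<close>.
\<close>

lemma independent_coefficients_bounded:
  fixes B :: "'a::real_normed_vector set"
  assumes "finite B" and "independent B"
  shows "\<exists>C\<ge>0. \<forall>c. (\<Sum>b\<in>B. \<bar>c b\<bar>) \<le> C * norm (\<Sum>b\<in>B. c b *\<^sub>R b)"
  using assms
proof (induction B)
  case empty
  then show ?case by auto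
next
  case (insert a B)
  have a: "a \<notin> span B"
    using insert.prems insert.hyps by (simp add: independent_insert)
  obtain C where C: "C \<ge> 0" "\<And>c. (\<Sum>b\<in>B. \<bar>c b\<bar>) \<le> C * norm (\<Sum>b\<in>B. c b *\<^sub>R b)"
    using insert by (auto simp: independent_insert)
  let ?v = "\<lambda>c. \<Sum>b\<in>B. c b *\<^sub>R b"
  \<comment> \<open>Otherwise \<open>- a\<close> is a limit of elements of \<open>span B\<close>; their coefficients converge, so \<open>a \<in> span B\<close>.\<close>
  have "\<exists>\<delta>>0. \<forall>c. \<delta> \<le> norm (a + ?v c)"
  proof (rule ccontr)
    assume "\<not> ?thesis"
    then have "\<forall>n. \<exists>c. norm (a + ?v c) < inverse (real (Suc n))"
      by (metis inverse_positive_iff_positive not_less of_nat_0_less_iff zero_less_Suc)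
    then obtain s where s: "\<And>n. norm (a + ?v (s n)) < inverse (real (Suc n))"
      by metis
    have "(\<lambda>n. a + ?v (s n)) \<longlonglongrightarrow> 0"
      by (rule Lim_null_comparison[OF _ LIMSEQ_inverse_real_of_nat])
        (use s in \<open>auto intro!: always_eventually less_imp_le\<close>)
    then have "(\<lambda>n. - a + (a + ?v (s n))) \<longlonglongrightarrow> - a + 0"
      by (intro tendsto_intros)
    then have lim: "(\<lambda>n. ?v (s n)) \<longlonglongrightarrow> - a"
      by simp
    then have cau: "Cauchy (\<lambda>n. ?v (s n))"
      using LIMSEQ_imp_Cauchy by blast
    have "\<exists>l. (\<lambda>n. s n b) \<longlonglongrightarrow> l" if b: "b \<in> B" for b
    proof -
      have *: "\<bar>s m b - s n b\<bar> \<le> C * norm (?v (s m) - ?v (s n))" for m n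
      proof -
        have "\<bar>s m b - s n b\<bar> \<le> (\<Sum>b\<in>B. \<bar>s m b - s n b\<bar>)"
          using member_le_sum[of b B "\<lambda>b. \<bar>s m b - s n b\<bar>"] b insert.hyps by auto
        also have "\<dots> \<le> C * norm (?v (\<lambda>b. s m b - s n b))"
          by (rule C(2))
        finally show ?thesis
          by (simp add: scaleR_left_diff_distrib sum_subtractf)
      qed
      have "Cauchy (\<lambda>n. s n b)"
      proof (rule metric_CauchyI)
        fix e :: real assume e: "e > 0"
        then have "e / (C + 1) > 0" using C(1) by simp
        then obtain M where M: "\<And>m n. m \<ge> M \<Longrightarrow> n \<ge> M \<Longrightarrow> dist (?v (s m)) (?v (s n)) < e / (C + 1)"
          using metric_CauchyD[OF cau] by blast
        have "dist (s m b) (s n b) < e" if "m \<ge> M" "n \<ge> M" for m n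
        proof -
          have "dist (s m b) (s n b) \<le> (C + 1) * norm (?v (s m) - ?v (s n))"
            using *[of m n] by (simp add: dist_real_def distrib_right add_increasing2)
          also have "\<dots> < (C + 1) * (e / (C + 1))"
            using M[OF that] C(1) by (intro mult_strict_left_mono) (auto simp: dist_norm)
          finally show ?thesis using C(1) by simp
        qed
        then show "\<exists>M. \<forall>m\<ge>M. \<forall>n\<ge>M. dist (s m b) (s n b) < e" by blast
      qed
      then show ?thesis
        using convergent_def real_Cauchy_convergent by blast
    qed
    then obtain l where l: "\<And>b. b \<in> B \<Longrightarrow> (\<lambda>n. s n b) \<longlonglongrightarrow> l b"
      by metis
    have "(\<lambda>n. ?v (s n)) \<longlonglongrightarrow> ?v l"
      by (intro tendsto_intros l)
    then have "- a = ?v l"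
      using lim LIMSEQ_unique by blast
    moreover have "?v l \<in> span B"
      by (intro span_sum span_scale span_base)
    ultimately show False
      using a span_neg[of "- a" B] by (metis minus_minus)
  qed
  then obtain \<delta> where \<delta>: "\<delta> > 0" "\<And>c. \<delta> \<le> norm (a + ?v c)"
    by blast
  let ?K = "inverse \<delta> * (1 + C * norm a) + C"
  have "(\<Sum>b\<in>insert a B. \<bar>c b\<bar>) \<le> ?K * norm (\<Sum>b\<in>insert a B. c b *\<^sub>R b)" for c
  proof -
    let ?N = "norm (c a *\<^sub>R a + ?v c)"
    have 1: "\<bar>c a\<bar> \<le> inverse \<delta> * ?N"
    proof (cases "c a = 0")
      case False
      have "c a *\<^sub>R (a + ?v (\<lambda>b. c b / c a)) = c a *\<^sub>R a + ?v c"
        using False by (simp add: scaleR_right_distrib scaleR_sum_right)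
      then have "?N = \<bar>c a\<bar> * norm (a + ?v (\<lambda>b. c b / c a))"
        by (metis norm_scaleR)
      also have "\<dots> \<ge> \<bar>c a\<bar> * \<delta>"
        using \<delta>(2) by (intro mult_left_mono) auto
      finally show ?thesis
        using \<delta>(1) by (simp add: field_simps)
    qed (use \<delta>(1) in auto)
    have "norm (?v c) \<le> ?N + \<bar>c a\<bar> * norm a"
      using norm_triangle_ineq4[of "c a *\<^sub>R a + ?v c" "c a *\<^sub>R a"] by simp
    then have "(\<Sum>b\<in>B. \<bar>c b\<bar>) \<le> C * (?N + \<bar>c a\<bar> * norm a)"
      using C(2)[of c] C(1) by (meson mult_left_mono order_trans)
    also have "\<dots> \<le> C * (?N + inverse \<delta> * ?N * norm a)"
      using C(1) 1 by (intro mult_left_mono add_left_mono mult_right_mono) auto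
    finally have "\<bar>c a\<bar> + (\<Sum>b\<in>B. \<bar>c b\<bar>) \<le> ?K * ?N"
      using 1 by (simp add: algebra_simps)
    then show ?thesis
      using insert.hyps by simp
  qed
  moreover have "?K \<ge> 0"
    using C(1) \<delta>(1) by simp
  ultimately show ?case by blast
qed

text \<open>
  Expanding a direction \<open>w\<close> in a basis is what turns the directional derivatives of \<open>Ck_on\<close> into a total
  derivative, provided that the coordinates are continuous.
\<close>

lemma fin_dim_bounded_coordinates:
  obtains B :: "'a::fin_dim set" and c :: "'a \<Rightarrow> 'a \<Rightarrow> real"
  where "finite B" "\<And>b. b \<in> B \<Longrightarrow> bounded_linear (c b)" "\<And>w. w = (\<Sum>b\<in>B. c b w *\<^sub>R b)"
proof -
  obtain B0 :: "'a set" where B0: "finite B0" "span B0 = UNIV"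
    using fin_dim by blast
  obtain B where B: "B \<subseteq> B0" "independent B" "B0 \<subseteq> span B"
    using maximal_independent_subset .
  have fin: "finite B"
    using B(1) B0(1) finite_subset by blast
  have sp: "span B = UNIV"
    using B(3) B0(2) by (metis span_minimal subspace_span top.extremum_unique)
  define c where "c = (\<lambda>b w. representation B w b)"
  have rep: "(\<Sum>b\<in>B. c b w *\<^sub>R b) = w" for w
    unfolding c_def using B(2) sp fin by (intro sum_representation_eq) auto
  obtain C where C: "\<And>c. (\<Sum>b\<in>B. \<bar>c b\<bar>) \<le> C * norm (\<Sum>b\<in>B. c b *\<^sub>R b)"
    using independent_coefficients_bounded[OF fin B(2)] by blast
  have "bounded_linear (c b)" if "b \<in> B" for b
  proof (rule bounded_linear_intro[of _ C])
    show "c b (x + y) = c b x + c b y" for x y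
      unfolding c_def using B(2) sp by (simp add: representation_add)
    show "c b (r *\<^sub>R x) = r *\<^sub>R c b x" for r x
      unfolding c_def using B(2) sp by (simp add: representation_scale)
    have "\<bar>c b x\<bar> \<le> (\<Sum>b\<in>B. \<bar>c b x\<bar>)" for x
      using member_le_sum[of b B "\<lambda>b. \<bar>c b x\<bar>"] that fin by auto
    then show "norm (c b x) \<le> norm x * C" for x
      using C[of "\<lambda>b. c b x"] by (simp add: rep mult.commute) (meson order_trans)
  qed
  then show thesis
    using that[of B c] fin rep by simp
qed

text \<open>
  The linear combinations of a basis with rational coefficients form a countable dense set.
\<close>

lemma second_countable_fin_dim: "second_countable (euclidean :: 'a::fin_dim topology)"
proof -
  obtain B :: "'a set" and c where B: "finite B" "\<And>b. b \<in> B \<Longrightarrow> bounded_linear (c b)"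
    and rep: "\<And>w. w = (\<Sum>b\<in>B. c b w *\<^sub>R b)"
    using fin_dim_bounded_coordinates by blast
  define D where "D = (\<lambda>q. \<Sum>b\<in>B. q b *\<^sub>R b) ` (\<Pi>\<^sub>E b\<in>B. \<rat>)"
  have cD: "countable D"
    unfolding D_def using B(1) by (intro countable_image countable_PiE) (auto simp: countable_rat)
  have dense: "\<exists>d\<in>D. dist d x < e" if e: "e > 0" for x e
  proof -
    let ?K = "1 + (\<Sum>b\<in>B. norm b)"
    have K: "?K > 0" by (smt (verit) norm_ge_zero sum_nonneg)
    have "\<exists>q\<in>\<rat>. \<bar>q - c b x\<bar> < e / ?K" for b
      using Rats_dense_in_real[of "c b x - e / ?K" "c b x + e / ?K"] e K
      by (smt (verit) divide_pos_pos)
    then obtain q where q: "\<And>b. q b \<in> \<rat>" "\<And>b. \<bar>q b - c b x\<bar> < e / ?K"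
      by metis
    have "(\<Sum>b\<in>B. q b *\<^sub>R b) - x = (\<Sum>b\<in>B. (q b - c b x) *\<^sub>R b)"
      by (subst rep[of x]) (simp add: scaleR_left_diff_distrib sum_subtractf)
    then have "dist (\<Sum>b\<in>B. q b *\<^sub>R b) x \<le> (\<Sum>b\<in>B. norm ((q b - c b x) *\<^sub>R b))"
      by (metis dist_norm norm_sum)
    also have "\<dots> \<le> (\<Sum>b\<in>B. e / ?K * norm b)"
      unfolding norm_scaleR by (intro sum_mono mult_right_mono less_imp_le[OF q(2)] norm_ge_zero)
    also have "\<dots> < e / ?K * ?K"
      using e K by (subst sum_distrib_left[symmetric], intro mult_strict_left_mono) auto
    finally have "dist (\<Sum>b\<in>B. q b *\<^sub>R b) x < e"
      using K by simp
    moreover have "(\<Sum>b\<in>B. q b *\<^sub>R b) = (\<Sum>b\<in>B. restrict q B b *\<^sub>R b)"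
      by simp
    moreover have "(\<Sum>b\<in>B. restrict q B b *\<^sub>R b) \<in> D"
      unfolding D_def using q(1) by (intro imageI) auto
    ultimately show ?thesis by metis
  qed
  let ?\<B> = "(\<lambda>(d, n). ball d (inverse (real (Suc n)))) ` (D \<times> UNIV)"
  have "\<exists>V\<in>?\<B>. x \<in> V \<and> V \<subseteq> U" if U: "open U" "x \<in> U" for U x
  proof -
    obtain e where e: "e > 0" "ball x e \<subseteq> U"
      using U open_contains_ball by blast
    obtain n where n: "inverse (real (Suc n)) < e / 2"
      using reals_Archimedean[of "e / 2"] e(1) by auto
    obtain d where d: "d \<in> D" "dist d x < inverse (real (Suc n))"
      using dense[of "inverse (real (Suc n))" x] by auto
    have "ball d (inverse (real (Suc n))) \<subseteq> ball x e"
    proof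
      fix y assume "y \<in> ball d (inverse (real (Suc n)))"
      then have "dist d y < inverse (real (Suc n))" by simp
      then have "dist x y < e"
        using dist_triangle2[of x y d] d(2) n by (simp add: dist_commute)
      then show "y \<in> ball x e" by simp
    qed
    moreover have "x \<in> ball d (inverse (real (Suc n)))"
      using d(2) by simp
    ultimately show ?thesis
      using d(1) e(2) by blast
  qed
  moreover have "countable ?\<B>"
    using cD by simp
  ultimately show ?thesis
    unfolding second_countable_def by (intro exI[of _ ?\<B>]) auto
qed

section \<open>Functions of class \<open>C\<^sup>k\<close>\<close>

lemma Ck_on_subset: "Ck_on k f S \<Longrightarrow> T \<subseteq> S \<Longrightarrow> Ck_on k f T"
  by (induction k arbitrary: f) (auto intro: continuous_on_subset)

lemma Ck_on_Suc_has_derivative: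
  assumes "Ck_on (Suc k) f S" and "x \<in> S"
  shows "(f has_derivative frechet_derivative f (at x)) (at x)"
proof -
  have "f differentiable at x"
    using assms by simp
  then show ?thesis
    by (rule frechet_derivative_works[THEN iffD1])
qed

lemma Ck_on_Suc_frechet_derivative:
  "Ck_on (Suc k) f S \<Longrightarrow> Ck_on k (\<lambda>x. frechet_derivative f (at x) v) S"
  unfolding Ck_on.simps(2) by (rule conjunct2[THEN spec])

text \<open>
  On an open set the full derivative depends only on the values of the function there; hence the
  openness assumptions here and below.
\<close>

lemma Ck_on_cong:
  assumes "open S" and "\<And>x. x \<in> S \<Longrightarrow> f x = g x" and "Ck_on k f S"
  shows "Ck_on k g S"
  using assms(2,3)
proof (induction k arbitrary: f g)
  case 0
  then show ?case
    using continuous_on_cong[of S S f g] by simp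
next
  case (Suc k)
  have "(g has_derivative frechet_derivative f (at x)) (at x)" if "x \<in> S" for x
    by (rule has_derivative_transform_within_open[OF
          Ck_on_Suc_has_derivative[OF Suc.prems(2) that] assms(1) that Suc.prems(1)])
  then have g: "g differentiable at x" "frechet_derivative g (at x) = frechet_derivative f (at x)"
    if "x \<in> S" for x
    using that by (blast intro: differentiableI, metis frechet_derivative_at)
  have "Ck_on k (\<lambda>x. frechet_derivative g (at x) v) S" for v
    by (rule Suc.IH[of "\<lambda>x. frechet_derivative f (at x) v"]) (use g Suc.prems in auto)
  then show ?case using g by simp
qed

lemma Ck_on_local:
  "(\<And>x. x \<in> S \<Longrightarrow> \<exists>T. open T \<and> x \<in> T \<and> Ck_on k f T) \<Longrightarrow> Ck_on k f S"
proof (induction k arbitrary: f)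
  case 0
  then have "isCont f x" if "x \<in> S" for x
    using "0"[OF that] by (auto simp: continuous_on_eq_continuous_at)
  then show ?case
    by (simp add: continuous_at_imp_continuous_on)
next
  case (Suc k)
  have "Ck_on k (\<lambda>x. frechet_derivative f (at x) v) S" for v
    by (rule Suc.IH) (use Suc.prems in fastforce)
  moreover have "f differentiable at x" if "x \<in> S" for x
    using Suc.prems[OF that] by auto
  ultimately show ?case by simp
qed

lemma Ck_on_SucI:
  assumes "open S"
    and "\<And>x. x \<in> S \<Longrightarrow> (f has_derivative f' x) (at x)"
    and "\<And>v. Ck_on k (\<lambda>x. f' x v) S"
  shows "Ck_on (Suc k) f S"
proof -
  have "Ck_on k (\<lambda>x. frechet_derivative f (at x) v) S" for v
    by (rule Ck_on_cong[OF assms(1) _ assms(3)[of v]])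
      (metis frechet_derivative_at[OF assms(2)])
  moreover have "f differentiable at x" if "x \<in> S" for x
    using assms(2)[OF that] by (rule differentiableI)
  ultimately show ?thesis
    unfolding Ck_on.simps(2) by (intro conjI ballI allI)
qed

lemma Ck_on_SucD: "Ck_on (Suc k) f S \<Longrightarrow> Ck_on k f S"
proof (induction k arbitrary: f)
  case 0
  then show ?case
    by (simp add: continuous_at_imp_continuous_on differentiable_imp_continuous_within)
next
  case (Suc k)
  then have "Ck_on k (\<lambda>x. frechet_derivative f (at x) v) S" for v
    using Ck_on.simps(2)[of "Suc k" f S] by blast
  then show ?case
    using Suc.prems by simp
qed

lemma Ck_on_const: "Ck_on k (\<lambda>x. c) S"
  by (induction k arbitrary: c) auto

lemma Ck_on_bounded_linear_compose:
  assumes "open S" and "bounded_linear L" and "Ck_on k f S"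
  shows "Ck_on k (\<lambda>x. L (f x)) S"
  using assms(3)
proof (induction k arbitrary: f)
  case 0
  then show ?case
    using assms(2) by (simp add: bounded_linear.continuous_on)
next
  case (Suc k)
  have "((\<lambda>x. L (f x)) has_derivative (\<lambda>v. L (frechet_derivative f (at x) v))) (at x)" if "x \<in> S" for x
    by (rule bounded_linear.has_derivative[OF assms(2)]) (rule Ck_on_Suc_has_derivative[OF Suc.prems that])
  moreover have "Ck_on k (\<lambda>x. L (frechet_derivative f (at x) v)) S" for v
    by (rule Suc.IH) (rule Ck_on_Suc_frechet_derivative[OF Suc.prems])
  ultimately show ?case
    by (rule Ck_on_SucI[OF assms(1)])
qed

lemma Ck_on_id: "open S \<Longrightarrow> Ck_on k (\<lambda>x. x) S"
  by (cases k) (auto intro!: Ck_on_const)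

lemma Ck_on_bounded_linear: "open S \<Longrightarrow> bounded_linear L \<Longrightarrow> Ck_on k L S"
  using Ck_on_bounded_linear_compose[OF _ _ Ck_on_id] by blast

lemma Ck_on_Pair:
  assumes "open S" and "Ck_on k f S" and "Ck_on k g S"
  shows "Ck_on k (\<lambda>x. (f x, g x)) S"
  using assms(2,3)
proof (induction k arbitrary: f g)
  case 0
  then show ?case by (simp add: continuous_on_Pair)
next
  case (Suc k)
  have "((\<lambda>x. (f x, g x)) has_derivative
      (\<lambda>v. (frechet_derivative f (at x) v, frechet_derivative g (at x) v))) (at x)" if "x \<in> S" for x
    by (intro has_derivative_Pair Ck_on_Suc_has_derivative[OF Suc.prems(1) that]
        Ck_on_Suc_has_derivative[OF Suc.prems(2) that])
  moreover have "Ck_on k (\<lambda>x. (frechet_derivative f (at x) v, frechet_derivative g (at x) v)) S" for v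
    by (intro Suc.IH Ck_on_Suc_frechet_derivative Suc.prems)
  ultimately show ?case
    by (rule Ck_on_SucI[OF assms(1)])
qed

lemma Ck_on_add:
  assumes "open S" and "Ck_on k f S" and "Ck_on k g S"
  shows "Ck_on k (\<lambda>x. f x + g x) S"
  by (rule Ck_on_bounded_linear_compose[OF assms(1) _ Ck_on_Pair[OF assms],
        where L = "\<lambda>z. fst z + snd z", simplified])
    (intro bounded_linear_add bounded_linear_fst bounded_linear_snd)

lemma Ck_on_sum:
  assumes "open S" and "\<And>i. i \<in> I \<Longrightarrow> Ck_on k (f i) S"
  shows "Ck_on k (\<lambda>x. \<Sum>i\<in>I. f i x) S"
  using assms(2)
  by (induction I rule: infinite_finite_induct) (auto intro!: Ck_on_const Ck_on_add assms(1))

lemma Ck_on_scaleR: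
  assumes "open S" and "Ck_on k f S" and "Ck_on k g S"
  shows "Ck_on k (\<lambda>x. f x *\<^sub>R g x) S"
  using assms(2,3)
proof (induction k arbitrary: f g)
  case 0
  then show ?case by (simp add: continuous_on_scaleR)
next
  case (Suc k)
  have "((\<lambda>x. f x *\<^sub>R g x) has_derivative
      (\<lambda>v. f x *\<^sub>R frechet_derivative g (at x) v + frechet_derivative f (at x) v *\<^sub>R g x)) (at x)"
    if "x \<in> S" for x
    by (intro has_derivative_scaleR Ck_on_Suc_has_derivative[OF Suc.prems(1) that]
        Ck_on_Suc_has_derivative[OF Suc.prems(2) that])
  moreover have "Ck_on k (\<lambda>x. f x *\<^sub>R frechet_derivative g (at x) v
      + frechet_derivative f (at x) v *\<^sub>R g x) S" for v
    by (intro Ck_on_add assms(1) Suc.IH Ck_on_SucD[OF Suc.prems(1)] Ck_on_SucD[OF Suc.prems(2)]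
        Ck_on_Suc_frechet_derivative Suc.prems)
  ultimately show ?case
    by (rule Ck_on_SucI[OF assms(1)])
qed

text \<open>
  The chain rule gives \<open>D(g \<circ> f)(x) v = Dg(f x) (Df(x) v)\<close>, where the direction of differentiation of \<open>g\<close> depends on
  \<open>x\<close>. Expanded in a basis it becomes \<open>\<Sum>b. c b (Df(x) v) *\<^sub>R Dg(f x) b\<close>, whose directions are
  constant, so that the induction hypothesis applies to each \<open>y \<mapsto> Dg(y) b\<close>.
\<close>

lemma Ck_on_compose:
  fixes f :: "'a::fin_dim \<Rightarrow> 'b::fin_dim" and g :: "'b \<Rightarrow> 'c::fin_dim"
  assumes "open S" and "open T" and "f ` S \<subseteq> T" and "Ck_on k f S" and "Ck_on k g T"
  shows "Ck_on k (g \<circ> f) S"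
  using assms(4,5)
proof (induction k arbitrary: g)
  case 0
  then show ?case
    using assms(3) by (simp add: continuous_on_compose continuous_on_subset del: comp_apply)
next
  case (Suc k)
  obtain B :: "'b set" and c where B: "finite B" "\<And>b. b \<in> B \<Longrightarrow> bounded_linear (c b)"
    and rep: "\<And>w. w = (\<Sum>b\<in>B. c b w *\<^sub>R b)"
    using fin_dim_bounded_coordinates by blast
  let ?Df = "\<lambda>x. frechet_derivative f (at x)"
  let ?Dg = "\<lambda>y. frechet_derivative g (at y)"
  have Df: "(f has_derivative ?Df x) (at x)" if "x \<in> S" for x
    using Suc.prems(1) that by (rule Ck_on_Suc_has_derivative)
  have Dg: "(g has_derivative ?Dg (f x)) (at (f x))" if "x \<in> S" for x
    using Suc.prems(2) assms(3) that by (intro Ck_on_Suc_has_derivative) auto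
  have fk: "Ck_on k f S"
    using Suc.prems(1) by (rule Ck_on_SucD)
  have smooth: "Ck_on k (\<lambda>x. \<Sum>b\<in>B. c b (?Df x v) *\<^sub>R (?Dg (f x) b)) S" for v
  proof (intro Ck_on_sum Ck_on_scaleR assms(1))
    fix b assume b: "b \<in> B"
    show "Ck_on k (\<lambda>x. c b (?Df x v)) S"
      by (rule Ck_on_bounded_linear_compose[OF assms(1) B(2)[OF b]
            Ck_on_Suc_frechet_derivative[OF Suc.prems(1)]])
    show "Ck_on k (\<lambda>x. ?Dg (f x) b) S"
      using Suc.IH[OF fk Ck_on_Suc_frechet_derivative[OF Suc.prems(2)], of b]
      unfolding comp_def .
  qed
  have expand: "(\<Sum>b\<in>B. c b w *\<^sub>R ?Dg (f x) b) = ?Dg (f x) w" if "x \<in> S" for x w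
  proof -
    have lin: "linear (?Dg (f x))"
      using Dg[OF that] by (rule has_derivative_linear)
    have "?Dg (f x) w = ?Dg (f x) (\<Sum>b\<in>B. c b w *\<^sub>R b)"
      by (rule arg_cong[where f = "?Dg (f x)", OF rep])
    also have "\<dots> = (\<Sum>b\<in>B. c b w *\<^sub>R ?Dg (f x) b)"
      by (simp only: linear_sum[OF lin] linear_cmul[OF lin])
    finally show ?thesis by (rule sym)
  qed
  have "Ck_on k (\<lambda>x. ?Dg (f x) (?Df x v)) S" for v
    by (rule Ck_on_cong[OF assms(1) expand smooth])
  moreover have "((g \<circ> f) has_derivative (\<lambda>v. ?Dg (f x) (?Df x v))) (at x)" if "x \<in> S" for x
    using diff_chain_at[OF Df[OF that] Dg[OF that]] by (simp add: comp_def)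
  ultimately show ?case
    by (intro Ck_on_SucI[OF assms(1)])
qed

lemma smooth_on_subset: "smooth_on f S \<Longrightarrow> T \<subseteq> S \<Longrightarrow> smooth_on f T"
  unfolding smooth_on_def by (blast intro: Ck_on_subset)

lemma smooth_on_cong:
  "open S \<Longrightarrow> (\<And>x. x \<in> S \<Longrightarrow> f x = g x) \<Longrightarrow> smooth_on f S \<Longrightarrow> smooth_on g S"
  unfolding smooth_on_def by (blast intro: Ck_on_cong)

lemma smooth_on_local:
  "(\<And>x. x \<in> S \<Longrightarrow> \<exists>T. open T \<and> x \<in> T \<and> smooth_on f T) \<Longrightarrow> smooth_on f S"
  unfolding smooth_on_def by (meson Ck_on_local)

lemma smooth_on_const: "smooth_on (\<lambda>x. c) S"
  unfolding smooth_on_def by (simp add: Ck_on_const)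

lemma smooth_on_bounded_linear: "open S \<Longrightarrow> bounded_linear L \<Longrightarrow> smooth_on L S"
  unfolding smooth_on_def by (simp add: Ck_on_bounded_linear)

lemma smooth_on_Pair:
  "open S \<Longrightarrow> smooth_on f S \<Longrightarrow> smooth_on g S \<Longrightarrow> smooth_on (\<lambda>x. (f x, g x)) S"
  unfolding smooth_on_def by (simp add: Ck_on_Pair)

lemma smooth_on_compose:
  "open S \<Longrightarrow> open T \<Longrightarrow> f ` S \<subseteq> T \<Longrightarrow> smooth_on f S \<Longrightarrow> smooth_on g T \<Longrightarrow> smooth_on (g \<circ> f) S"
  unfolding smooth_on_def by (blast intro: Ck_on_compose)

lemma smooth_on_imp_differentiable: "smooth_on f S \<Longrightarrow> x \<in> S \<Longrightarrow> f differentiable at x"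
  unfolding smooth_on_def by (metis Ck_on.simps(2))

section \<open>Smooth manifolds and smooth maps\<close>

lemma second_countable_prod_topology:
  assumes "second_countable X" and "second_countable Y"
  shows "second_countable (prod_topology X Y)"
proof -
  obtain \<A> where \<A>: "countable \<A>" "\<And>V. V \<in> \<A> \<Longrightarrow> openin X V"
    "\<And>U x. openin X U \<Longrightarrow> x \<in> U \<Longrightarrow> \<exists>V\<in>\<A>. x \<in> V \<and> V \<subseteq> U"
    using assms(1) unfolding second_countable_def by metis
  obtain \<B> where \<B>: "countable \<B>" "\<And>V. V \<in> \<B> \<Longrightarrow> openin Y V"
    "\<And>U x. openin Y U \<Longrightarrow> x \<in> U \<Longrightarrow> \<exists>V\<in>\<B>. x \<in> V \<and> V \<subseteq> U"
    using assms(2) unfolding second_countable_def by metis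
  let ?\<C> = "(\<lambda>(A, B). A \<times> B) ` (\<A> \<times> \<B>)"
  have "\<exists>W\<in>?\<C>. z \<in> W \<and> W \<subseteq> U" if U: "openin (prod_topology X Y) U" "z \<in> U" for U z
  proof -
    obtain A B where AB: "openin X A" "openin Y B" "fst z \<in> A" "snd z \<in> B" "A \<times> B \<subseteq> U"
      using U unfolding openin_prod_topology_alt by (metis prod.collapse)
    obtain A' where A': "A' \<in> \<A>" "fst z \<in> A'" "A' \<subseteq> A"
      using \<A>(3) AB by metis
    obtain B' where B': "B' \<in> \<B>" "snd z \<in> B'" "B' \<subseteq> B"
      using \<B>(3) AB by metis
    have "z \<in> A' \<times> B'" "A' \<times> B' \<subseteq> U" "A' \<times> B' \<in> ?\<C>"
      using A' B' AB(5) by (auto simp: mem_Times_iff)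
    then show ?thesis
      by (intro bexI[of _ "A' \<times> B'"] conjI)
  qed
  moreover have "countable ?\<C>"
    using \<A>(1) \<B>(1) by simp
  moreover have "openin (prod_topology X Y) W" if "W \<in> ?\<C>" for W
    using that \<A>(2) \<B>(2) by (auto simp: openin_prod_Times_iff)
  ultimately show ?thesis
    unfolding second_countable_def by (intro exI[of _ ?\<C>] conjI ballI allI impI) (simp_all only:)
qed

lemma smooth_manifold_chart:
  assumes "smooth_manifold M" and "(U, c) \<in> atlas M"
  shows chart_openin: "openin (mtop M) U"
    and chart_homeomorphic_map: "homeomorphic_map (subtopology (mtop M) U) (top_of_set (c ` U)) c"
    and chart_open_range: "open (c ` U)"
    and chart_subset: "U \<subseteq> points M"
    and chart_inj_on: "inj_on c U"
proof -
  show 1: "openin (mtop M) U" "open (c ` U)"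
    and 2: "homeomorphic_map (subtopology (mtop M) U) (top_of_set (c ` U)) c"
    using assms unfolding smooth_manifold_def by auto
  show 3: "U \<subseteq> points M"
    using 1(1) by (rule openin_subset)
  show "inj_on c U"
    using homeomorphic_imp_injective_map[OF 2] 3 by (simp add: Int_absorb1)
qed

lemma chart_at:
  assumes "smooth_manifold M" and "x \<in> points M"
  obtains U c where "(U, c) \<in> atlas M" and "x \<in> U"
proof -
  have "x \<in> (\<Union>(U, c)\<in>atlas M. U)"
    using assms unfolding smooth_manifold_def by simp
  then show thesis using that by auto
qed

lemma chart_transition_smooth:
  "smooth_manifold M \<Longrightarrow> (U, c) \<in> atlas M \<Longrightarrow> (V, d) \<in> atlas M \<Longrightarrow>
    smooth_on (d \<circ> inv_into U c) (c ` (U \<inter> V))"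
  unfolding smooth_manifold_def by blast

lemma chart_open_image:
  assumes "smooth_manifold M" and "(U, c) \<in> atlas M" and "openin (mtop M) W"
  shows "open (c ` (U \<inter> W))"
proof -
  have "openin (subtopology (mtop M) U) (U \<inter> W)"
    using assms(3) by (simp add: openin_subtopology_Int2)
  then have "openin (top_of_set (c ` U)) (c ` (U \<inter> W))"
    using homeomorphic_imp_open_map[OF chart_homeomorphic_map[OF assms(1,2)]]
    by (simp add: open_map_def)
  then show ?thesis
    using chart_open_range[OF assms(1,2)] by (simp add: openin_open_eq)
qed

text \<open>
  The coordinate expression of a smooth map is required to be smooth on exactly these sets.
\<close>

lemma chart_open_preimage:
  assumes "smooth_manifold M" and "(U, c) \<in> atlas M"
    and "continuous_map (mtop M) X f" and "openin X V"
  shows "open (c ` {x \<in> U. f x \<in> V})"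
proof -
  have "openin (mtop M) {x \<in> points M. f x \<in> V}"
    using assms(3,4) by (rule openin_continuous_map_preimage)
  then have "open (c ` (U \<inter> {x \<in> points M. f x \<in> V}))"
    by (rule chart_open_image[OF assms(1,2)])
  moreover have "U \<inter> {x \<in> points M. f x \<in> V} = {x \<in> U. f x \<in> V}"
    using chart_subset[OF assms(1,2)] by auto
  ultimately show ?thesis by simp
qed

lemma smooth_map_imp_continuous_map: "smooth_map M N f \<Longrightarrow> continuous_map (mtop M) (mtop N) f"
  by (simp add: smooth_map_def)

lemma smooth_map_points: "smooth_map M N f \<Longrightarrow> x \<in> points M \<Longrightarrow> f x \<in> points N"
  by (meson continuous_map_funspace funcset_mem smooth_map_imp_continuous_map)

lemma smooth_map_in_charts:
  "smooth_map M N f \<Longrightarrow> (U, c) \<in> atlas M \<Longrightarrow> (V, d) \<in> atlas N \<Longrightarrow>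
    smooth_on (d \<circ> f \<circ> inv_into U c) (c ` {x \<in> U. f x \<in> V})"
  unfolding smooth_map_def by blast

lemma smooth_mapI:
  assumes "continuous_map (mtop M) (mtop N) f"
    and "\<And>U c V d. (U, c) \<in> atlas M \<Longrightarrow> (V, d) \<in> atlas N \<Longrightarrow>
      smooth_on (d \<circ> f \<circ> inv_into U c) (c ` {x \<in> U. f x \<in> V})"
  shows "smooth_map M N f"
  unfolding smooth_map_def using assms by blast

lemma smooth_map_id:
  assumes "smooth_manifold M"
  shows "smooth_map M M (\<lambda>x. x)"
proof (rule smooth_mapI)
  fix U c V d assume "(U, c) \<in> atlas M" "(V, d) \<in> atlas M"
  then show "smooth_on (d \<circ> (\<lambda>x. x) \<circ> inv_into U c) (c ` {x \<in> U. x \<in> V})"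
    using chart_transition_smooth[OF assms, of U c V d] by (simp add: comp_def Int_def)
qed simp

lemma smooth_map_const:
  assumes "a \<in> points N"
  shows "smooth_map M N (\<lambda>x. a)"
  by (rule smooth_mapI) (use assms in \<open>auto simp: comp_def smooth_on_const\<close>)

text \<open>
  Smoothness in charts \<open>(U, c)\<close> and \<open>(W, e)\<close> is local, so near each point a chart \<open>(V, d)\<close> of the middle
  manifold can be inserted between them.
\<close>

lemma smooth_map_compose:
  assumes "smooth_manifold M" and "smooth_manifold N" and "smooth_manifold P"
    and f: "smooth_map M N f" and g: "smooth_map N P g"
  shows "smooth_map M P (\<lambda>x. g (f x))"
proof (rule smooth_mapI)
  show "continuous_map (mtop M) (mtop P) (\<lambda>x. g (f x))"
    using continuous_map_compose[OF f[THEN smooth_map_imp_continuous_map]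
        g[THEN smooth_map_imp_continuous_map]] by (simp add: comp_def)
  fix U c W e assume U: "(U, c) \<in> atlas M" and W: "(W, e) \<in> atlas P"
  show "smooth_on (e \<circ> (\<lambda>x. g (f x)) \<circ> inv_into U c) (c ` {x \<in> U. g (f x) \<in> W})"
  proof (rule smooth_on_local)
    fix z assume "z \<in> c ` {x \<in> U. g (f x) \<in> W}"
    then obtain x where x: "x \<in> U" "g (f x) \<in> W" "z = c x"
      by blast
    have "f x \<in> points N"
      using smooth_map_points[OF f] chart_subset[OF assms(1) U] x(1) by blast
    then obtain V d where V: "(V, d) \<in> atlas N" "f x \<in> V"
      using chart_at[OF assms(2)] by blast
    let ?V' = "{y \<in> V. g y \<in> W}"
    have "openin (mtop N) {y \<in> points N. g y \<in> W}"
      by (rule openin_continuous_map_preimage[OF smooth_map_imp_continuous_map[OF g]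
            chart_openin[OF assms(3) W]])
    then have "openin (mtop N) (V \<inter> {y \<in> points N. g y \<in> W})"
      using chart_openin[OF assms(2) V(1)] by (rule openin_Int[rotated])
    moreover have "V \<inter> {y \<in> points N. g y \<in> W} = ?V'"
      using chart_subset[OF assms(2) V(1)] by auto
    ultimately have V': "openin (mtop N) ?V'" by simp
    let ?T = "c ` {x \<in> U. f x \<in> ?V'}"
    have T: "open ?T"
      by (rule chart_open_preimage[OF assms(1) U smooth_map_imp_continuous_map[OF f] V'])
    have inv_c: "inv_into U c (c x) = x" if "x \<in> U" for x
      using chart_inj_on[OF assms(1) U] that by simp
    have inv_d: "inv_into V d (d y) = y" if "y \<in> V" for y
      using chart_inj_on[OF assms(2) V(1)] that by simp
    have "smooth_on ((e \<circ> g \<circ> inv_into V d) \<circ> (d \<circ> f \<circ> inv_into U c)) ?T"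
    proof (rule smooth_on_compose[OF T])
      show "open (d ` ?V')"
        by (rule chart_open_preimage[OF assms(2) V(1) smooth_map_imp_continuous_map[OF g]
              chart_openin[OF assms(3) W]])
      show "(d \<circ> f \<circ> inv_into U c) ` ?T \<subseteq> d ` ?V'"
        by (auto simp: inv_c)
      show "smooth_on (d \<circ> f \<circ> inv_into U c) ?T"
        by (rule smooth_on_subset[OF smooth_map_in_charts[OF f U V(1)]]) auto
      show "smooth_on (e \<circ> g \<circ> inv_into V d) (d ` ?V')"
        by (rule smooth_map_in_charts[OF g V(1) W])
    qed
    then have "smooth_on (e \<circ> (\<lambda>x. g (f x)) \<circ> inv_into U c) ?T"
      by (rule smooth_on_cong[OF T, rotated]) (auto simp: inv_c inv_d)
    moreover have "z \<in> ?T"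
      using x V(2) by auto
    ultimately show "\<exists>T. open T \<and> z \<in> T \<and> smooth_on (e \<circ> (\<lambda>x. g (f x)) \<circ> inv_into U c) T"
      using T by blast
  qed
qed

lemma mtop_prod_manifold [simp]: "mtop (M \<times>\<^sub>M N) = prod_topology (mtop M) (mtop N)"
  by (simp add: prod_manifold_def)

lemma atlas_prod_manifold:
  "atlas (M \<times>\<^sub>M N) = {(U \<times> V, map_prod c d) |U c V d. (U, c) \<in> atlas M \<and> (V, d) \<in> atlas N}"
  by (simp add: prod_manifold_def)

lemma atlas_prod_manifoldE:
  assumes "(W, e) \<in> atlas (M \<times>\<^sub>M N)"
  obtains U c V d where "W = U \<times> V" "e = map_prod c d" "(U, c) \<in> atlas M" "(V, d) \<in> atlas N"
  using assms unfolding atlas_prod_manifold by blast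

text \<open>
  The inverse of a product chart is the product of the inverses; with this, statements about product
  manifolds reduce to statements about the factors.
\<close>

lemma inv_into_prod_chart:
  assumes "smooth_manifold M" and "(U, c) \<in> atlas M" and "smooth_manifold N" and "(V, d) \<in> atlas N"
    and "x \<in> U" and "y \<in> V"
  shows "inv_into (U \<times> V) (map_prod c d) (c x, d y) = (x, y)"
  using inv_into_f_f[OF map_prod_inj_on[OF chart_inj_on[OF assms(1,2)] chart_inj_on[OF assms(3,4)]], of "(x, y)"]
    assms(5,6) by simp

lemma smooth_map_Pair:
  assumes "smooth_manifold M" and "smooth_manifold N" and "smooth_manifold P"
    and f: "smooth_map M N f" and g: "smooth_map M P g"
  shows "smooth_map M (N \<times>\<^sub>M P) (\<lambda>x. (f x, g x))"
proof (rule smooth_mapI)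
  show "continuous_map (mtop M) (mtop (N \<times>\<^sub>M P)) (\<lambda>x. (f x, g x))"
    using f g by (simp add: smooth_map_def continuous_map_pairedI)
  fix U c W e assume U: "(U, c) \<in> atlas M" and "(W, e) \<in> atlas (N \<times>\<^sub>M P)"
  then obtain V d V' d' where W: "W = V \<times> V'" "e = map_prod d d'"
    and V: "(V, d) \<in> atlas N" and V': "(V', d') \<in> atlas P"
    by (blast elim: atlas_prod_manifoldE)
  let ?S = "c ` {x \<in> U. (f x, g x) \<in> W}"
  have "open (c ` {x \<in> U. (f x, g x) \<in> V \<times> V'})"
    using f g chart_openin[OF assms(2) V] chart_openin[OF assms(3) V']
    by (intro chart_open_preimage[OF assms(1) U continuous_map_pairedI])
      (auto simp: smooth_map_def openin_prod_Times_iff)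
  then have S: "open ?S" using W by simp
  have "smooth_on (\<lambda>z. ((d \<circ> f \<circ> inv_into U c) z, (d' \<circ> g \<circ> inv_into U c) z)) ?S"
    by (intro smooth_on_Pair S smooth_on_subset[OF smooth_map_in_charts[OF f U V]]
        smooth_on_subset[OF smooth_map_in_charts[OF g U V']]) (auto simp: W)
  then show "smooth_on (e \<circ> (\<lambda>x. (f x, g x)) \<circ> inv_into U c) ?S"
    by (simp add: W(2) comp_def)
qed

lemma smooth_on_map_prod:
  assumes "open S" and "open T" and "smooth_on f S" and "smooth_on g T"
  shows "smooth_on (map_prod f g) (S \<times> T)"
proof -
  have ST: "open (S \<times> T)" using assms(1,2) by (rule open_Times)
  have "smooth_on (\<lambda>z. ((f \<circ> fst) z, (g \<circ> snd) z)) (S \<times> T)"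
    by (intro smooth_on_Pair ST smooth_on_compose[OF ST assms(1) _ _ assms(3)]
        smooth_on_compose[OF ST assms(2) _ _ assms(4)] smooth_on_bounded_linear
        bounded_linear_fst bounded_linear_snd) auto
  then show ?thesis
    by (simp add: map_prod_def case_prod_unfold)
qed

lemma smooth_manifold_prod:
  assumes M: "smooth_manifold M" and N: "smooth_manifold N"
  shows "smooth_manifold (M \<times>\<^sub>M N)"
proof -
  have cover: "(\<Union>(W, e)\<in>atlas (M \<times>\<^sub>M N). W) = points (M \<times>\<^sub>M N)"
  proof (intro subset_antisym subsetI)
    fix z assume "z \<in> (\<Union>(W, e)\<in>atlas (M \<times>\<^sub>M N). W)"
    then show "z \<in> points (M \<times>\<^sub>M N)"
      using chart_subset[OF M] chart_subset[OF N] by (fastforce simp: atlas_prod_manifold)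
  next
    fix z assume "z \<in> points (M \<times>\<^sub>M N)"
    then have "fst z \<in> points M" "snd z \<in> points N" by auto
    then obtain U c V d where "(U, c) \<in> atlas M" "fst z \<in> U" "(V, d) \<in> atlas N" "snd z \<in> V"
      using chart_at[OF M] chart_at[OF N] by metis
    then have "(U \<times> V, map_prod c d) \<in> atlas (M \<times>\<^sub>M N)" "z \<in> U \<times> V"
      by (auto simp: atlas_prod_manifold mem_Times_iff)
    then show "z \<in> (\<Union>(W, e)\<in>atlas (M \<times>\<^sub>M N). W)" by blast
  qed
  have chart: "openin (mtop (M \<times>\<^sub>M N)) W \<and> open (e ` W) \<and>
      homeomorphic_map (subtopology (mtop (M \<times>\<^sub>M N)) W) (top_of_set (e ` W)) e"
    if We: "(W, e) \<in> atlas (M \<times>\<^sub>M N)" for W e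
  proof -
    obtain U c V d where W: "W = U \<times> V" "e = map_prod c d"
      and U: "(U, c) \<in> atlas M" and V: "(V, d) \<in> atlas N"
      using We by (rule atlas_prod_manifoldE)
    have eW: "e ` W = c ` U \<times> d ` V"
      unfolding W by (rule map_prod_surj_on) auto
    obtain c' d' where
      "homeomorphic_maps (subtopology (mtop M) U) (top_of_set (c ` U)) c c'"
      "homeomorphic_maps (subtopology (mtop N) V) (top_of_set (d ` V)) d d'"
      using chart_homeomorphic_map[OF M U] chart_homeomorphic_map[OF N V]
      unfolding homeomorphic_map_maps by blast
    then have "homeomorphic_maps
        (prod_topology (subtopology (mtop M) U) (subtopology (mtop N) V))
        (prod_topology (top_of_set (c ` U)) (top_of_set (d ` V)))
        (\<lambda>(x, y). (c x, d y)) (\<lambda>(x, y). (c' x, d' y))"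
      unfolding homeomorphic_maps_prod by blast
    then have "homeomorphic_map (subtopology (mtop (M \<times>\<^sub>M N)) W) (top_of_set (e ` W)) e"
      unfolding eW using W
      by (auto simp: subtopology_Times map_prod_def homeomorphic_map_maps simp del: topspace_prod_topology)
    then show ?thesis
      unfolding eW using chart_openin[OF M U] chart_openin[OF N V]
        chart_open_range[OF M U] chart_open_range[OF N V]
      by (simp add: W openin_prod_Times_iff open_Times)
  qed
  have transition: "smooth_on (e' \<circ> inv_into W e) (e ` (W \<inter> W'))"
    if We: "(W, e) \<in> atlas (M \<times>\<^sub>M N)" and We': "(W', e') \<in> atlas (M \<times>\<^sub>M N)" for W e W' e'
  proof -
    obtain U c V d where W: "W = U \<times> V" "e = map_prod c d"
      and U: "(U, c) \<in> atlas M" and V: "(V, d) \<in> atlas N"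
      using We by (rule atlas_prod_manifoldE)
    obtain U' c' V' d' where W': "W' = U' \<times> V'" "e' = map_prod c' d'"
      and U': "(U', c') \<in> atlas M" and V': "(V', d') \<in> atlas N"
      using We' by (rule atlas_prod_manifoldE)
    have eW: "e ` (W \<inter> W') = c ` (U \<inter> U') \<times> d ` (V \<inter> V')"
      unfolding W W' Times_Int_Times by (rule map_prod_surj_on) auto
    have op: "open (c ` (U \<inter> U'))" "open (d ` (V \<inter> V'))"
      using chart_open_image[OF M U chart_openin[OF M U']]
        chart_open_image[OF N V chart_openin[OF N V']] by auto
    have "smooth_on (map_prod (c' \<circ> inv_into U c) (d' \<circ> inv_into V d)) (e ` (W \<inter> W'))"
      unfolding eW by (intro smooth_on_map_prod op chart_transition_smooth[OF M U U']
          chart_transition_smooth[OF N V V'])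
    then show ?thesis
      unfolding eW by (rule smooth_on_cong[OF open_Times[OF op], rotated])
        (auto simp: W W' inv_into_prod_chart[OF M U N V] chart_inj_on[OF M U] chart_inj_on[OF N V])
  qed
  have "Hausdorff_space (mtop (M \<times>\<^sub>M N))" "second_countable (mtop (M \<times>\<^sub>M N))"
    using M N by (simp_all add: smooth_manifold_def Hausdorff_space_prod_topology
        second_countable_prod_topology)
  then show ?thesis
    unfolding smooth_manifold_def
    by (intro conjI cover ballI case_prodI2) (simp_all only: chart transition)
qed

lemma smooth_map_fst:
  assumes M: "smooth_manifold M" and N: "smooth_manifold N"
  shows "smooth_map (M \<times>\<^sub>M N) M fst"
proof (rule smooth_mapI)
  show "continuous_map (mtop (M \<times>\<^sub>M N)) (mtop M) fst"
    by (simp add: continuous_map_fst)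
  fix W e V d assume "(W, e) \<in> atlas (M \<times>\<^sub>M N)" and V: "(V, d) \<in> atlas M"
  then obtain U c U' c' where W: "W = U \<times> U'" "e = map_prod c c'"
    and U: "(U, c) \<in> atlas M" and U': "(U', c') \<in> atlas N"
    by (blast elim: atlas_prod_manifoldE)
  have "{z \<in> W. fst z \<in> V} = (U \<inter> V) \<times> U'"
    unfolding W by auto
  then have eW: "e ` {z \<in> W. fst z \<in> V} = c ` (U \<inter> V) \<times> c' ` U'"
    unfolding W by (auto intro: map_prod_surj_on)
  have op: "open (c ` (U \<inter> V))"
    by (rule chart_open_image[OF M U chart_openin[OF M V]])
  have op2: "open (c ` (U \<inter> V) \<times> c' ` U')"
    using op chart_open_range[OF N U'] by (rule open_Times)
  have "smooth_on ((d \<circ> inv_into U c) \<circ> fst) (c ` (U \<inter> V) \<times> c' ` U')"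
    by (intro smooth_on_compose[OF op2 op] chart_transition_smooth[OF M U V]
        smooth_on_bounded_linear op2 bounded_linear_fst) auto
  then show "smooth_on (d \<circ> fst \<circ> inv_into W e) (e ` {z \<in> W. fst z \<in> V})"
    unfolding eW
    by (rule smooth_on_cong[OF op2, rotated])
      (auto simp: W inv_into_prod_chart[OF M U N U'] chart_inj_on[OF M U])
qed

lemma smooth_map_snd:
  assumes M: "smooth_manifold M" and N: "smooth_manifold N"
  shows "smooth_map (M \<times>\<^sub>M N) N snd"
proof (rule smooth_mapI)
  show "continuous_map (mtop (M \<times>\<^sub>M N)) (mtop N) snd"
    by (simp add: continuous_map_snd)
  fix W e V d assume "(W, e) \<in> atlas (M \<times>\<^sub>M N)" and V: "(V, d) \<in> atlas N"
  then obtain U c U' c' where W: "W = U \<times> U'" "e = map_prod c c'"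
    and U: "(U, c) \<in> atlas M" and U': "(U', c') \<in> atlas N"
    by (blast elim: atlas_prod_manifoldE)
  have "{z \<in> W. snd z \<in> V} = U \<times> (U' \<inter> V)"
    unfolding W by auto
  then have eW: "e ` {z \<in> W. snd z \<in> V} = c ` U \<times> c' ` (U' \<inter> V)"
    unfolding W by (auto intro: map_prod_surj_on)
  have op: "open (c' ` (U' \<inter> V))"
    by (rule chart_open_image[OF N U' chart_openin[OF N V]])
  have op2: "open (c ` U \<times> c' ` (U' \<inter> V))"
    using chart_open_range[OF M U] op by (rule open_Times)
  have "smooth_on ((d \<circ> inv_into U' c') \<circ> snd) (c ` U \<times> c' ` (U' \<inter> V))"
    by (intro smooth_on_compose[OF op2 op] chart_transition_smooth[OF N U' V]
        smooth_on_bounded_linear op2 bounded_linear_snd) auto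
  then show "smooth_on (d \<circ> snd \<circ> inv_into W e) (e ` {z \<in> W. snd z \<in> V})"
    unfolding eW
    by (rule smooth_on_cong[OF op2, rotated])
      (auto simp: W inv_into_prod_chart[OF M U N U'] chart_inj_on[OF N U'])
qed

lemma smooth_manifold_vec_mfd: "smooth_manifold (vec_mfd :: ('a::fin_dim, 'a) manifold)"
  unfolding smooth_manifold_def vec_mfd_def
  by (simp add: second_countable_fin_dim smooth_on_bounded_linear bounded_linear_ident id_def
      inv_id[unfolded id_def] comp_def homeomorphic_map_id[unfolded id_def])

text \<open>
  Restricting to all points changes nothing, since charts are already defined on sets of points.
\<close>

lemma open_submanifold_points:
  assumes "smooth_manifold M"
  shows "open_submanifold M (points M) = M"
proof (rule manifold.equality)
  have "U \<inter> points M = U" if "(U, c) \<in> atlas M" for U c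
    using chart_subset[OF assms that] by blast
  then show "atlas (open_submanifold M (points M)) = atlas M"
    unfolding open_submanifold_def by auto force
qed (simp_all add: open_submanifold_def)

lemma smooth_map_imp_smooth_map_on:
  assumes "smooth_manifold M" and "smooth_map M N f" and "A \<subseteq> points M"
  shows "smooth_map_on M A N f"
  unfolding smooth_map_on_def
proof
  fix x assume "x \<in> A"
  then show "\<exists>W F. openin (mtop M) W \<and> x \<in> W \<and> smooth_map (open_submanifold M W) N F \<and>
      (\<forall>y\<in>A \<inter> W. F y = f y)"
    using assms by (intro exI[of _ "points M"] exI[of _ f]) (auto simp: open_submanifold_points)
qed

text \<open>
  In charts \<open>f \<circ> s = id\<close> near \<open>f x\<close>, so the derivative of \<open>s\<close> is a right inverse of the derivative of \<open>f\<close> at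
  \<open>x\<close>.
\<close>

lemma submersion_if_sections:
  assumes M: "smooth_manifold M" and N: "smooth_manifold N" and f: "smooth_map M N f"
    and sections: "\<And>x. x \<in> points M \<Longrightarrow>
      \<exists>s. smooth_map N M s \<and> s (f x) = x \<and> (\<forall>y\<in>points N. f (s y) = y)"
  shows "submersion M N f"
  unfolding submersion_def
proof (intro conjI f ballI impI)
  fix C D x assume C: "C \<in> atlas M" and D: "D \<in> atlas N" and x: "x \<in> fst C" "f x \<in> fst D"
  obtain U c V d where CD: "C = (U, c)" "D = (V, d)"
    by fastforce
  note U = C[unfolded CD] and V = D[unfolded CD]
  have xU: "x \<in> U" "f x \<in> V" using x CD by auto
  obtain s where s: "smooth_map N M s" "s (f x) = x" "\<forall>y\<in>points N. f (s y) = y"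
    using sections chart_subset[OF M U] xU(1) by blast
  let ?\<phi> = "d \<circ> f \<circ> inv_into U c" and ?\<sigma> = "c \<circ> s \<circ> inv_into V d"
  let ?O = "d ` {y \<in> V. s y \<in> U}"
  have inv_c: "inv_into U c (c x) = x" if "x \<in> U" for x
    using chart_inj_on[OF M U] that by simp
  have inv_d: "inv_into V d (d y) = y" if "y \<in> V" for y
    using chart_inj_on[OF N V] that by simp
  have O: "open ?O"
    by (rule chart_open_preimage[OF N V smooth_map_imp_continuous_map[OF s(1)] chart_openin[OF M U]])
  have dO: "d (f x) \<in> ?O"
    using xU s(2) by auto
  have \<sigma>x: "?\<sigma> (d (f x)) = c x"
    using xU s(2) by (simp add: inv_d)
  have "?\<phi> differentiable at (c x)"
    by (rule smooth_on_imp_differentiable[OF smooth_map_in_charts[OF f U V]]) (use xU in auto)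
  then have D\<phi>: "(?\<phi> has_derivative frechet_derivative ?\<phi> (at (c x))) (at (?\<sigma> (d (f x))))"
    unfolding \<sigma>x by (rule frechet_derivative_works[THEN iffD1])
  have "?\<sigma> differentiable at (d (f x))"
    by (rule smooth_on_imp_differentiable[OF smooth_map_in_charts[OF s(1) V U] dO])
  then have D\<sigma>: "(?\<sigma> has_derivative frechet_derivative ?\<sigma> (at (d (f x)))) (at (d (f x)))"
    by (rule frechet_derivative_works[THEN iffD1])
  have "(?\<phi> \<circ> ?\<sigma> has_derivative
      frechet_derivative ?\<phi> (at (c x)) \<circ> frechet_derivative ?\<sigma> (at (d (f x)))) (at (d (f x)))"
    by (rule diff_chain_at[OF D\<sigma> D\<phi>])
  moreover have "(?\<phi> \<circ> ?\<sigma>) z = z" if "z \<in> ?O" for z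
    using that s(3) chart_subset[OF N V] by (auto simp: inv_c inv_d)
  ultimately have "((\<lambda>z. z) has_derivative
      frechet_derivative ?\<phi> (at (c x)) \<circ> frechet_derivative ?\<sigma> (at (d (f x)))) (at (d (f x)))"
    by (rule has_derivative_transform_within_open[OF _ O dO])
  then have comp: "frechet_derivative ?\<phi> (at (c x)) \<circ> frechet_derivative ?\<sigma> (at (d (f x))) = (\<lambda>z. z)"
    using has_derivative_ident by (rule has_derivative_unique)
  have "frechet_derivative ?\<phi> (at (c x)) (frechet_derivative ?\<sigma> (at (d (f x))) z) = z" for z
    using fun_cong[OF comp, of z] by (simp only: comp_apply)
  then have "surj (frechet_derivative ?\<phi> (at (c x)))"
    by (rule surjI)
  then show "surj (chart_derivative C D f x)"
    by (simp add: chart_derivative_def CD)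
qed

lemma smooth_map_fst_of:
  assumes "smooth_map M (N \<times>\<^sub>M P) f"
    and "smooth_manifold M" and "smooth_manifold N" and "smooth_manifold P"
  shows "smooth_map M N (\<lambda>x. fst (f x))"
  using assms by (intro smooth_map_compose[OF _ _ _ assms(1) smooth_map_fst] smooth_manifold_prod)

lemma smooth_map_snd_of:
  assumes "smooth_map M (N \<times>\<^sub>M P) f"
    and "smooth_manifold M" and "smooth_manifold N" and "smooth_manifold P"
  shows "smooth_map M P (\<lambda>x. snd (f x))"
  using assms by (intro smooth_map_compose[OF _ _ _ assms(1) smooth_map_snd] smooth_manifold_prod)

section \<open>Lie groups\<close>

lemma lie_group_smooth_manifold: "lie_group G \<Longrightarrow> smooth_manifold (mfd G)"
  by (simp add: lie_group_def)

lemma lie_group_points: "lie_group G \<Longrightarrow> points (mfd G) = carrier G"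
  by (simp add: lie_group_def)

lemma lie_group_group: "lie_group G \<Longrightarrow> Group.group G"
  by (simp add: lie_group_def)

lemma smooth_map_mult:
  assumes G: "lie_group G" and M: "smooth_manifold M"
    and f: "smooth_map M (mfd G) f" and g: "smooth_map M (mfd G) g"
  shows "smooth_map M (mfd G) (\<lambda>x. f x \<otimes>\<^bsub>G\<^esub> g x)"
proof -
  note G' = lie_group_smooth_manifold[OF G]
  have "smooth_map (mfd G \<times>\<^sub>M mfd G) (mfd G) (\<lambda>(x, y). x \<otimes>\<^bsub>G\<^esub> y)"
    using G by (simp add: lie_group_def)
  from smooth_map_compose[OF M smooth_manifold_prod[OF G' G'] G' smooth_map_Pair[OF M G' G' f g] this]
  show ?thesis by simp
qed

lemma smooth_map_m_inv:
  assumes G: "lie_group G" and M: "smooth_manifold M" and f: "smooth_map M (mfd G) f"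
  shows "smooth_map M (mfd G) (\<lambda>x. inv\<^bsub>G\<^esub> (f x))"
proof -
  have "smooth_map (mfd G) (mfd G) (\<lambda>x. inv\<^bsub>G\<^esub> x)"
    using G by (simp add: lie_group_def)
  from smooth_map_compose[OF M _ _ f this] show ?thesis
    using lie_group_smooth_manifold[OF G] by blast
qed

lemma points_vec_mfd: "points vec_mfd = UNIV"
  by (simp add: vec_mfd_def)

lemma points_prod_manifold: "points (M \<times>\<^sub>M N) = points M \<times> points N"
  by simp

section \<open>The groupoid \<open>X\<^sub>e\<close> and its action\<close>

text \<open>
  The structure maps by projections instead of patterns, the form to which the rules for smoothness
  apply.
\<close>

lemma Xe_groupoid_simps:
  fixes H :: "('a, 'c::fin_dim) lie_group" and G :: "('a, 'b::fin_dim) lie_group"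
  shows "arrows (Xe_groupoid H G) = (mfd H \<times>\<^sub>M mfd H) \<times>\<^sub>M (vec_mfd \<times>\<^sub>M mfd G \<times>\<^sub>M vec_mfd)"
    and "base (Xe_groupoid H G) = mfd H \<times>\<^sub>M vec_mfd"
    and "tgt (Xe_groupoid H G) = (\<lambda>x. (fst (fst x), fst (snd x)))"
    and "src (Xe_groupoid H G) = (\<lambda>x. (snd (fst x), snd (snd (snd x))))"
    and "gunit (Xe_groupoid H G) = (\<lambda>b. ((fst b, fst b), (snd b, \<one>\<^bsub>G\<^esub>, snd b)))"
    and "gmult (Xe_groupoid H G) = (\<lambda>x y. ((fst (fst x), snd (fst y)),
           (fst (snd x), fst (snd (snd x)) \<otimes>\<^bsub>G\<^esub> fst (snd (snd y)), snd (snd (snd y)))))"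
  by (auto simp: Xe_groupoid_def prod_groupoid_def coarse_groupoid_def X_groupoid_def
      map_prod_def case_prod_unfold fun_eq_iff)

text \<open>
  To be applied with \<open>rule\<close>, repeatedly. In each projection rule the premise on the map precedes the
  premises on the manifolds: solving it is what instantiates the unknown factor of the product.
\<close>

lemmas smooth_intros =
  smooth_map_id smooth_map_Pair smooth_map_fst_of smooth_map_snd_of
  smooth_manifold_prod smooth_manifold_vec_mfd lie_group_smooth_manifold
  smooth_map_mult smooth_map_m_inv

text \<open>
  Target and source read two components of an arrow, so prescribing these two and keeping the others fixed
  gives smooth sections through any given arrow; hence both maps are submersions.
\<close>

lemma lie_groupoid_Xe:
  fixes H :: "('a, 'c::fin_dim) lie_group" and G :: "('a, 'b::fin_dim) lie_group"
  assumes H: "lie_group H" and G: "lie_group G"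
  shows "lie_groupoid (Xe_groupoid H G)"
proof -
  let ?X = "Xe_groupoid H G"
  interpret G: Group.group G
    using G by (rule lie_group_group)
  note points = points_prod_manifold points_vec_mfd lie_group_points[OF H] lie_group_points[OF G]
  have A: "smooth_manifold (arrows ?X)" and B: "smooth_manifold (base ?X)"
    unfolding Xe_groupoid_simps by (rule smooth_intros H G)+
  have tgt: "smooth_map (arrows ?X) (base ?X) (tgt ?X)"
    and src: "smooth_map (arrows ?X) (base ?X) (src ?X)"
    unfolding Xe_groupoid_simps by (rule smooth_intros H G)+
  have "\<exists>s. smooth_map (base ?X) (arrows ?X) s \<and> s (tgt ?X x) = x \<and>
      (\<forall>y\<in>points (base ?X). tgt ?X (s y) = y)" if "x \<in> points (arrows ?X)" for x
  proof -
    let ?s = "\<lambda>b. ((fst b, snd (fst x)), (snd b, fst (snd (snd x)), snd (snd (snd x))))"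
    have "fst (fst x) \<in> points (mfd H)" "snd (fst x) \<in> points (mfd H)"
      "fst (snd (snd x)) \<in> points (mfd G)"
      "p \<in> points (vec_mfd :: ('c dual, 'c dual) manifold)" for p
      using that unfolding Xe_groupoid_simps points by auto
    note const = this[THEN smooth_map_const]
    have "smooth_map (base ?X) (arrows ?X) ?s"
      unfolding Xe_groupoid_simps by (rule const smooth_intros H G)+
    then show ?thesis
      by (intro exI[of _ ?s]) (simp add: Xe_groupoid_simps)
  qed
  then have tgt_sub: "submersion (arrows ?X) (base ?X) (tgt ?X)"
    by (rule submersion_if_sections[OF A B tgt])
  have "\<exists>s. smooth_map (base ?X) (arrows ?X) s \<and> s (src ?X x) = x \<and>
      (\<forall>y\<in>points (base ?X). src ?X (s y) = y)" if "x \<in> points (arrows ?X)" for x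
  proof -
    let ?s = "\<lambda>b. ((fst (fst x), fst b), (fst (snd x), fst (snd (snd x)), snd b))"
    have "fst (fst x) \<in> points (mfd H)" "snd (fst x) \<in> points (mfd H)"
      "fst (snd (snd x)) \<in> points (mfd G)"
      "p \<in> points (vec_mfd :: ('c dual, 'c dual) manifold)" for p
      using that unfolding Xe_groupoid_simps points by auto
    note const = this[THEN smooth_map_const]
    have "smooth_map (base ?X) (arrows ?X) ?s"
      unfolding Xe_groupoid_simps by (rule const smooth_intros H G)+
    then show ?thesis
      by (intro exI[of _ ?s]) (simp add: Xe_groupoid_simps)
  qed
  then have src_sub: "submersion (arrows ?X) (base ?X) (src ?X)"
    by (rule submersion_if_sections[OF A B src])
  have one: "\<one>\<^bsub>G\<^esub> \<in> points (mfd G)"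
    unfolding points by simp
  have unit: "smooth_map (base ?X) (arrows ?X) (gunit ?X)"
    unfolding Xe_groupoid_simps
    by (rule smooth_intros smooth_map_const[OF one] H G)+
  have "smooth_map (arrows ?X \<times>\<^sub>M arrows ?X) (arrows ?X) (\<lambda>(x, y). gmult ?X x y)"
    unfolding Xe_groupoid_simps case_prod_unfold by (rule smooth_intros H G)+
  then have mult: "smooth_map_on (arrows ?X \<times>\<^sub>M arrows ?X)
      {(x, y). x \<in> points (arrows ?X) \<and> y \<in> points (arrows ?X) \<and> src ?X x = tgt ?X y}
      (arrows ?X) (\<lambda>(x, y). gmult ?X x y)"
    by (intro smooth_map_imp_smooth_map_on smooth_manifold_prod A) auto
  let ?i = "\<lambda>x. ((snd (fst x), fst (fst x)),
    (snd (snd (snd x)), inv\<^bsub>G\<^esub> (fst (snd (snd x))), fst (snd x)))"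
  have inverse: "\<exists>i. smooth_map (arrows ?X) (arrows ?X) i \<and>
      (\<forall>x\<in>points (arrows ?X). tgt ?X (i x) = src ?X x \<and> src ?X (i x) = tgt ?X x \<and>
         gmult ?X x (i x) = gunit ?X (tgt ?X x) \<and> gmult ?X (i x) x = gunit ?X (src ?X x))"
  proof (intro exI[of _ ?i] conjI)
    show "smooth_map (arrows ?X) (arrows ?X) ?i"
      unfolding Xe_groupoid_simps by (rule smooth_intros H G)+
  qed (auto simp: Xe_groupoid_simps points)
  show ?thesis
    unfolding lie_groupoid_def
    by (intro conjI A B tgt_sub src_sub unit mult inverse)
      (auto simp: Xe_groupoid_simps points G.m_assoc)
qed

text \<open>
  The dressing action of \<open>G\<close>, pulled back along \<open>((h, k), (p, g, q)) \<mapsto> h g k\<inverse>\<close>. Compatibility with the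
  multiplication is the cancellation of \<open>k\<close> in \<open>(h g k\<inverse>) (k g' l\<inverse>)\<close>.
\<close>

lemma right_groupoid_action_Psi_plus:
  fixes H :: "('g, 'f::fin_dim) lie_group" and G :: "('g, 'e::fin_dim) lie_group"
    and Gs :: "('u, 'e dual) lie_group"
  assumes sub: "lie_subgroup H G" and Gs: "lie_group Gs"
    and phi: "right_dressing_action G Gs brs phi"
  shows "right_groupoid_action (Xe_groupoid H G) (mfd H \<times>\<^sub>M vec_mfd \<times>\<^sub>M mfd Gs) J_minus (Psi_plus G phi)"
proof -
  have H: "lie_group H" and G: "lie_group G" and subgroup: "subgroup (carrier H) G"
    and incl: "smooth_map (mfd H) (mfd G) (\<lambda>x. x)"
    using sub by (simp_all add: lie_subgroup_def immersion_def)
  interpret G: Group.group G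
    using G by (rule lie_group_group)
  have HG: "x \<in> carrier G" if "x \<in> carrier H" for x
    using subgroup.subset[OF subgroup] that by blast
  have phi_smooth: "smooth_map (mfd G \<times>\<^sub>M mfd Gs) (mfd Gs) (\<lambda>(x, u). phi x u)"
    using phi by (simp add: right_dressing_action_def)
  have phi_one: "phi \<one>\<^bsub>G\<^esub> u = u" if "u \<in> carrier Gs" for u
    using phi that by (simp add: right_dressing_action_def)
  have phi_mult: "phi (x \<otimes>\<^bsub>G\<^esub> y) u = phi y (phi x u)"
    if "x \<in> carrier G" "y \<in> carrier G" "u \<in> carrier Gs" for x y u
    using phi that by (simp add: right_dressing_action_def)
  let ?X = "Xe_groupoid H G"
  let ?S = "mfd H \<times>\<^sub>M (vec_mfd :: ('f dual, 'f dual) manifold) \<times>\<^sub>M mfd Gs"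
  note points = points_prod_manifold points_vec_mfd
    lie_group_points[OF H] lie_group_points[OF G] lie_group_points[OF Gs]
  have phi_closed: "phi x u \<in> carrier Gs" if "x \<in> carrier G" "u \<in> carrier Gs" for x u
    using smooth_map_points[OF phi_smooth, of "(x, u)"] that unfolding points by simp
  have S: "smooth_manifold ?S"
    by (rule smooth_intros H Gs)+
  have groupoid: "lie_groupoid ?X"
    using H G by (rule lie_groupoid_Xe)
  then have A: "smooth_manifold (arrows ?X)"
    by (simp add: lie_groupoid_def)
  have moment: "smooth_map ?S (base ?X) J_minus"
    unfolding Xe_groupoid_simps J_minus_def case_prod_unfold by (rule smooth_intros H Gs)+
  let ?P = "?S \<times>\<^sub>M arrows ?X"
  have P: "smooth_manifold ?P"
    using S A by (rule smooth_manifold_prod)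
  let ?h = "\<lambda>z :: ('g \<times> 'f dual \<times> 'u) \<times> ('g \<times> 'g) \<times> ('f dual \<times> 'g \<times> 'f dual). fst (fst z)"
  let ?k = "\<lambda>z :: ('g \<times> 'f dual \<times> 'u) \<times> ('g \<times> 'g) \<times> ('f dual \<times> 'g \<times> 'f dual). snd (fst (snd z))"
  have "smooth_map ?P (mfd H) ?h" "smooth_map ?P (mfd H) ?k"
    unfolding Xe_groupoid_simps by (rule smooth_intros H G Gs)+
  \<comment> \<open>In \<open>h g k\<inverse>\<close> the elements \<open>h\<close> and \<open>k\<close> of \<open>H\<close> are regarded in \<open>G\<close>; this uses that the inclusion is smooth.\<close>
  then have hk: "smooth_map ?P (mfd G) ?h" "smooth_map ?P (mfd G) ?k"
    using smooth_map_compose[OF P lie_group_smooth_manifold[OF H] lie_group_smooth_manifold[OF G] _ incl]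
    by blast+
  have "smooth_map ?P (mfd G \<times>\<^sub>M mfd Gs)
      (\<lambda>z. (?h z \<otimes>\<^bsub>G\<^esub> fst (snd (snd (snd z))) \<otimes>\<^bsub>G\<^esub> inv\<^bsub>G\<^esub> (?k z), snd (snd (fst z))))"
    using hk unfolding Xe_groupoid_simps by - (assumption | rule smooth_intros H G Gs)+
  from smooth_map_compose[OF P smooth_manifold_prod[OF lie_group_smooth_manifold[OF G]
        lie_group_smooth_manifold[OF Gs]] lie_group_smooth_manifold[OF Gs] this phi_smooth]
  have "smooth_map ?P (mfd Gs)
      (\<lambda>z. phi (?h z \<otimes>\<^bsub>G\<^esub> fst (snd (snd (snd z))) \<otimes>\<^bsub>G\<^esub> inv\<^bsub>G\<^esub> (?k z)) (snd (snd (fst z))))"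
    by simp
  then have "smooth_map ?P ?S (\<lambda>(s, x). Psi_plus G phi s x)"
    unfolding Xe_groupoid_simps Psi_plus_def case_prod_unfold fst_conv snd_conv
    by - (assumption | rule smooth_intros H G Gs)+
  then have smooth: "smooth_map_on ?P (fibre_product ?X ?S J_minus) ?S (\<lambda>(s, x). Psi_plus G phi s x)"
    by (rule smooth_map_imp_smooth_map_on[OF P]) (auto simp: fibre_product_def)
  have act: "phi (k \<otimes>\<^bsub>G\<^esub> g' \<otimes>\<^bsub>G\<^esub> inv\<^bsub>G\<^esub> l) (phi (h \<otimes>\<^bsub>G\<^esub> g \<otimes>\<^bsub>G\<^esub> inv\<^bsub>G\<^esub> k) u) =
      phi (h \<otimes>\<^bsub>G\<^esub> (g \<otimes>\<^bsub>G\<^esub> g') \<otimes>\<^bsub>G\<^esub> inv\<^bsub>G\<^esub> l) u"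
    if "h \<in> carrier G" "k \<in> carrier G" "l \<in> carrier G" "g \<in> carrier G" "g' \<in> carrier G"
      "u \<in> carrier Gs" for h k l g g' u
  proof -
    have "inv\<^bsub>G\<^esub> k \<otimes>\<^bsub>G\<^esub> (k \<otimes>\<^bsub>G\<^esub> y) = y" if "y \<in> carrier G" for y
      using that \<open>k \<in> carrier G\<close> by (simp add: G.m_assoc[symmetric])
    then have "h \<otimes>\<^bsub>G\<^esub> (g \<otimes>\<^bsub>G\<^esub> g') \<otimes>\<^bsub>G\<^esub> inv\<^bsub>G\<^esub> l =
        (h \<otimes>\<^bsub>G\<^esub> g \<otimes>\<^bsub>G\<^esub> inv\<^bsub>G\<^esub> k) \<otimes>\<^bsub>G\<^esub> (k \<otimes>\<^bsub>G\<^esub> g' \<otimes>\<^bsub>G\<^esub> inv\<^bsub>G\<^esub> l)"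
      using that by (simp add: G.m_assoc)
    then show ?thesis
      using that by (simp add: phi_mult)
  qed
  show ?thesis
    unfolding right_groupoid_action_def
    by (intro conjI groupoid S moment smooth)
      (auto simp: fibre_product_def Xe_groupoid_simps points J_minus_def Psi_plus_def HG act
        phi_closed phi_one)
qed

theorem proposition5p2p7:
  fixes G :: "('g, 'e::fin_dim) lie_group"
    and H :: "('g, 'f::fin_dim) lie_group"
    and R :: "'e dual \<Rightarrow>\<^sub>L 'e"
    and Gs :: "('u, 'e dual) lie_group"
    and brs :: "'u bracket"
    and phi :: "'g \<Rightarrow> 'u \<Rightarrow> 'u"
    and I :: "'u \<Rightarrow> 'f dual"
  assumes "lie_group G" and "connected_simply_connected G"
    and "lie_subgroup H G" and "connected_simply_connected H"
    and "\<And>A B. blinfun_apply A (blinfun_apply R B) = - blinfun_apply B (blinfun_apply R A)"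
    and "\<And>Y A B. blinfun_apply (ad G Y) (kappa G R A B)
           + kappa G R (ad_star G Y A) B + kappa G R A (ad_star G Y B) = 0"
    and "\<And>Z A. blinfun_apply R (ad_star G (blinfun_apply (lie_inclusion H G) Z) A)
           + blinfun_apply (ad G (blinfun_apply (lie_inclusion H G) Z)) (blinfun_apply R A) = 0"
    and "lie_group Gs" and "connected_simply_connected Gs"
    and "\<And>A B. blinfun_apply (ad Gs A) B
           = ad_star G (blinfun_apply R A) B - ad_star G (blinfun_apply R B) A"
    and "dual_poisson_lie_groups G (R_bracket G R) Gs brs"
    and "right_dressing_action G Gs brs phi"
    and "integrates_inclusion_transpose H G Gs I"
  shows "right_groupoid_action (Xe_groupoid H G) (arrows (Xstar_groupoid H Gs phi I))
           J_minus (Psi_plus G phi)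
       \<and> (\<forall>(h, p, u) \<in> points (arrows (Xstar_groupoid H Gs phi I)).
            \<forall>(p', g, q) \<in> points (arrows (X_groupoid G :: (_, _, 'f dual, _) groupoid)). p' = p \<longrightarrow>
              Psi_plus G phi (h, p, u) ((h, h), (p, g, q)) = psi_plus G phi (h, p, u) (p, g, q))"
proof
  have "arrows (Xstar_groupoid H Gs phi I) = mfd H \<times>\<^sub>M vec_mfd \<times>\<^sub>M mfd Gs"
    by (simp add: Xstar_groupoid_def)
  then show "right_groupoid_action (Xe_groupoid H G) (arrows (Xstar_groupoid H Gs phi I))
      J_minus (Psi_plus G phi)"
    using right_groupoid_action_Psi_plus assms(3,8,12) by metis
qed (auto simp: Psi_plus_def psi_plus_def)

end
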